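(* Let $a>0$ and $g\in L^2(\mathbb R)$. The following are equivalent: (1) There are numbers $A,B>0$ so that $A\le\langle g,g\rangle_a\le B$ a.e. (2) $(E_{m/a}g)_{m\in\mathbb Z}$ is a Riesz basic sequence. Hence, if $ab=1$, then (1) and (2) are equivalent to (3) $(E_{mb}g)_{m\in\mathbb Z}$ is a Riesz basic sequence with Riesz basis constants $\sqrt A,\sqrt B$, where $A,B$ are the numbers in (1).
   Context: For $c\in\mathbb R$, $E_cf(x)=e^{2\pi icx}f(x)$ for functions $f$ on $\mathbb R$. For $g\in L^2(\mathbb R)$, $\langle g,g\rangle_a(t)=\sum_{n\in\mathbb Z}|g(t-na)|^2$. A Riesz basis of a Hilbert space is a bounded unconditional basis. A sequence $(f_m)_{m\in\mathbb Z}$ in a Hilbert space is a Riesz basic sequence if it is a Riesz basis for its closed linear span. It has Riesz basis constants $\sqrt A,\sqrt B$ if $A\sum_m|c_m|^2\le\|\sum_m c_mf_m\|^2\le B\sum_m|c_m|^2$ for all square-summable scalar sequences $(c_m)_{m\in\mathbb Z}$.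
   Formalization: In (3), fixed A,B from (1) need not give constants √A,√B unless a=1 (a=1/2, g=1 on [0,1/2) fails); proved: (3) for some A,B>0 that also satisfy (1), and, for all A,B>0, the bounds in (1) hold iff it is a Riesz basic sequence with constants √(aA),√(aB). *)

theory Defs
  imports "HOL-Analysis.Analysis"
begin

text \<open>
  Elements of $L^2(\mathbb R)$ are represented by Lebesgue measurable, square integrable functions;
  two of them are the same vector iff they agree almost everywhere, that is, iff their distance
  in \<open>norm_L2\<close> is zero.  All notions below are invariant under this identification.
\<close>

definition L2 :: "(real \<Rightarrow> complex) set" where
  "L2 = {f \<in> borel_measurable lebesgue. integrable lebesgue (\<lambda>x. (cmod (f x))\<^sup>2)}"

definition norm_L2 :: "(real \<Rightarrow> complex) \<Rightarrow> real" where
  "norm_L2 f = sqrt (LINT x|lebesgue. (cmod (f x))\<^sup>2)"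

definition modulation :: "real \<Rightarrow> (real \<Rightarrow> complex) \<Rightarrow> real \<Rightarrow> complex" where
  "modulation c f = (\<lambda>x. exp (2 * complex_of_real pi * \<i> * complex_of_real (c * x)) * f x)"

text \<open>
  The bracket $\langle g,g\rangle_a(t)=\sum_{n\in\mathbb Z}|g(t-na)|^2$, taken in $[0,\infty]$ so
  that no value is assigned to a divergent sum by convention.
\<close>

definition bracket_self :: "real \<Rightarrow> (real \<Rightarrow> complex) \<Rightarrow> real \<Rightarrow> ennreal" where
  "bracket_self a g t = (\<Sum>\<^sub>\<infinity>n\<in>(UNIV :: int set). ennreal ((cmod (g (t - of_int n * a)))\<^sup>2))"

definition bracket_bounds :: "real \<Rightarrow> (real \<Rightarrow> complex) \<Rightarrow> real \<Rightarrow> real \<Rightarrow> bool" where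
  "bracket_bounds a g A B \<longleftrightarrow>
     (AE t in lebesgue. ennreal A \<le> bracket_self a g t \<and> bracket_self a g t \<le> ennreal B)"

text \<open>
  Unconditional convergence in $L^2(\mathbb R)$: the net of finite partial sums converges in norm.
  This is \<open>has_sum\<close> for the topology of \<open>norm_L2\<close>.  Membership of the sum in \<open>L2\<close> has to be
  required, since the Bochner integral of a non-integrable function is \<open>0\<close>.
\<close>

definition has_sum_L2 :: "(int \<Rightarrow> real \<Rightarrow> complex) \<Rightarrow> (real \<Rightarrow> complex) \<Rightarrow> bool" where
  "has_sum_L2 f s \<longleftrightarrow> s \<in> L2 \<and>
     ((\<lambda>F. norm_L2 (\<lambda>x. (\<Sum>m\<in>F. f m x) - s x)) \<longlongrightarrow> 0) (finite_subsets_at_top UNIV)"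

definition closed_span_L2 :: "(int \<Rightarrow> real \<Rightarrow> complex) \<Rightarrow> (real \<Rightarrow> complex) set" where
  "closed_span_L2 f = {h \<in> L2. \<forall>\<epsilon>>0. \<exists>F c. finite F \<and>
      norm_L2 (\<lambda>x. h x - (\<Sum>m\<in>F. c m * f m x)) < \<epsilon>}"

text \<open>
  In the next two definitions \<open>H\<close> stands for a closed subspace of $L^2(\mathbb R)$.
\<close>

definition unconditional_basis :: "(real \<Rightarrow> complex) set \<Rightarrow> (int \<Rightarrow> real \<Rightarrow> complex) \<Rightarrow> bool" where
  "unconditional_basis H f \<longleftrightarrow> (\<forall>m. f m \<in> H) \<and>
     (\<forall>h\<in>H. \<exists>!c :: int \<Rightarrow> complex. has_sum_L2 (\<lambda>m x. c m * f m x) h)"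

text \<open>
  As usual for bases, ``bounded'' means that the norms of the basis vectors are bounded above and
  bounded away from zero.
\<close>

definition riesz_basis :: "(real \<Rightarrow> complex) set \<Rightarrow> (int \<Rightarrow> real \<Rightarrow> complex) \<Rightarrow> bool" where
  "riesz_basis H f \<longleftrightarrow> unconditional_basis H f \<and>
     (\<exists>\<alpha>>0. \<exists>\<beta>. \<forall>m. \<alpha> \<le> norm_L2 (f m) \<and> norm_L2 (f m) \<le> \<beta>)"

definition riesz_basic_sequence :: "(int \<Rightarrow> real \<Rightarrow> complex) \<Rightarrow> bool" where
  "riesz_basic_sequence f \<longleftrightarrow> (\<forall>m. f m \<in> L2) \<and> riesz_basis (closed_span_L2 f) f"

text \<open>
  Convergence of $\sum_m c_mf_m$ for every square-summable $c$ is part of the definition.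
\<close>

definition has_riesz_constants :: "(int \<Rightarrow> real \<Rightarrow> complex) \<Rightarrow> real \<Rightarrow> real \<Rightarrow> bool" where
  "has_riesz_constants f \<alpha> \<beta> \<longleftrightarrow>
     (\<forall>c :: int \<Rightarrow> complex. (\<lambda>m. (cmod (c m))\<^sup>2) summable_on UNIV \<longrightarrow>
        (\<exists>s. has_sum_L2 (\<lambda>m x. c m * f m x) s \<and>
             \<alpha>\<^sup>2 * (\<Sum>\<^sub>\<infinity>m. (cmod (c m))\<^sup>2) \<le> (norm_L2 s)\<^sup>2 \<and>
             (norm_L2 s)\<^sup>2 \<le> \<beta>\<^sup>2 * (\<Sum>\<^sub>\<infinity>m. (cmod (c m))\<^sup>2)))"

end

theory Submission
  imports Defs
begin

text \<open>
  For a trigonometric polynomial $p=\sum_m c_m e^{2\pi i m t/a}$, periodization gives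
  $\|\sum_m c_m E_{m/a}g\|^2=\int_0^a |p|^2\langle g,g\rangle_a$, while
  $\int_0^a|p|^2=a\sum_m|c_m|^2$.  Hence bounds $A,B$ on the bracket are equivalent to the Riesz
  inequalities with constants $aA,aB$ on finite sums; for the converse one lets $|p|^2$ tend
  boundedly almost everywhere to the indicator function of a set on which the bracket violates a bound.

  Riesz inequalities on finite sums extend to square-summable sequences and to the closed span by
  completeness.  Conversely, in an unconditional basis the projections onto finite sets of
  coordinates are uniformly bounded, by a Baire category argument, so changing the signs of the
  coefficients changes norms by at most a constant factor.  By the parallelogram law some choice of
  signs makes $\|\sum_m\pm c_mf_m\|^2$ at most (and another one at least) $\sum_m|c_m|^2\|f_m\|^2$, and
  boundedness of the basis gives the Riesz inequalities.
\<close>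

section \<open>The seminormed space $L^2(\mathbb R)$\<close>

text \<open>An unconditional basis is only required to give unique convergent expansions. Continuity
  of the coordinates is not part of that requirement, and extracting it is the reason for a category
  argument. Vectors are functions and \<open>norm_L2\<close> is a seminorm, so completeness, nested
  balls and the summation of corrections are carried out with explicit sequences, and equality of
  sums becomes seminorm distance zero. Working with finite sums, as in \<open>riesz_bounds\<close>,
  separates the inequalities from convergence and makes trigonometric polynomials available as test
  functions.

  The factor a is genuine: optimal bracket bounds A, B correspond to optimal squared Riesz constants
  a A, a B, so for a \<noteq> 1 a given pair from (1) need not serve as squared constants. Clause
  (3) is therefore proved in two forms: with one common pair, obtained by enlarging the interval
  [A, B], and for every fixed pair with the constants sqrt (a A), sqrt (a B), where the equivalence
  is exact.\<close>

lemma L2_measurable [measurable_dest]: "f \<in> L2 \<Longrightarrow> f \<in> borel_measurable lebesgue"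
  by (simp add: L2_def)

lemma L2_integrable: "f \<in> L2 \<Longrightarrow> integrable lebesgue (\<lambda>x. (cmod (f x))\<^sup>2)"
  by (simp add: L2_def)

lemma L2I_bound:
  assumes "f \<in> borel_measurable lebesgue" "integrable lebesgue k" "\<And>x. (cmod (f x))\<^sup>2 \<le> k x"
  shows "f \<in> L2"
proof -
  have [measurable]: "f \<in> borel_measurable lebesgue" by fact
  have "integrable lebesgue (\<lambda>x. (cmod (f x))\<^sup>2)"
    by (rule Bochner_Integration.integrable_bound[OF assms(2)])
       (use assms(3) in \<open>auto intro!: AE_I2 intro: order_trans[OF _ abs_ge_self]\<close>)
  then show ?thesis using assms(1) by (simp add: L2_def)
qed

text \<open>Young's inequality for the cross term, with a free weight: t = 1 gives closure of
  \<open>L2\<close> under addition, an optimised t gives the triangle inequality with constant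
  one.\<close>

lemma cmod_add_sq_weighted:
  assumes "t > 0"
  shows "(cmod (u + v))\<^sup>2 \<le> (1 + t) * (cmod u)\<^sup>2 + (1 + 1 / t) * (cmod v)\<^sup>2"
proof -
  have "(cmod (u + v))\<^sup>2 \<le> (cmod u + cmod v)\<^sup>2"
    by (simp add: norm_triangle_ineq power_mono)
  moreover have "0 \<le> (t * cmod u - cmod v)\<^sup>2 / t" using assms by simp
  then have "2 * cmod u * cmod v \<le> t * (cmod u)\<^sup>2 + (cmod v)\<^sup>2 / t"
    using assms by (simp add: power2_eq_square field_simps)
  ultimately show ?thesis by (simp add: power2_sum algebra_simps)
qed

lemma L2_add: "f \<in> L2 \<Longrightarrow> h \<in> L2 \<Longrightarrow> (\<lambda>x. f x + h x) \<in> L2"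
  using cmod_add_sq_weighted[of 1]
  by (intro L2I_bound[where k = "\<lambda>x. 2 * (cmod (f x))\<^sup>2 + 2 * (cmod (h x))\<^sup>2"])
     (auto simp: L2_measurable intro!: Bochner_Integration.integrable_add integrable_mult_right L2_integrable)

lemma L2_cmult: "f \<in> L2 \<Longrightarrow> (\<lambda>x. c * f x) \<in> L2"
  by (intro L2I_bound[where k = "\<lambda>x. (cmod c)\<^sup>2 * (cmod (f x))\<^sup>2"])
     (auto simp: L2_measurable norm_mult power_mult_distrib intro!: integrable_mult_right L2_integrable)

lemma L2_zero: "(\<lambda>x. 0) \<in> L2"
  by (simp add: L2_def)

lemma L2_diff: "f \<in> L2 \<Longrightarrow> h \<in> L2 \<Longrightarrow> (\<lambda>x. f x - h x) \<in> L2"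
  using L2_add[of f "\<lambda>x. (-1) * h x"] L2_cmult[of h "-1"] by simp

lemma L2_sum: "(\<And>m. m \<in> F \<Longrightarrow> f m \<in> L2) \<Longrightarrow> (\<lambda>x. \<Sum>m\<in>F. f m x) \<in> L2"
  by (induction F rule: infinite_finite_induct) (auto simp: L2_zero intro: L2_add)

lemma L2_lincomb: "(\<And>m. f m \<in> L2) \<Longrightarrow> (\<lambda>x. \<Sum>m\<in>F. c m * f m x) \<in> L2"
  by (intro L2_sum L2_cmult)

lemma norm_L2_nonneg [simp]: "0 \<le> norm_L2 f"
  by (simp add: norm_L2_def)

lemma norm_L2_sq: "(norm_L2 f)\<^sup>2 = (LINT x|lebesgue. (cmod (f x))\<^sup>2)"
  by (simp add: norm_L2_def)

lemma norm_L2_zero [simp]: "norm_L2 (\<lambda>x. 0) = 0"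
  by (simp add: norm_L2_def)

lemma norm_L2_cmult: "norm_L2 (\<lambda>x. c * f x) = cmod c * norm_L2 f"
  by (simp add: norm_L2_def norm_mult power_mult_distrib real_sqrt_mult)

lemma norm_L2_minus_commute: "norm_L2 (\<lambda>x. f x - h x) = norm_L2 (\<lambda>x. h x - f x)"
  by (simp add: norm_L2_def norm_minus_commute)

lemma norm_L2_triangle:
  assumes "f \<in> L2" "h \<in> L2"
  shows "norm_L2 (\<lambda>x. f x + h x) \<le> norm_L2 f + norm_L2 h"
proof (rule field_le_epsilon)
  fix e :: real assume "e > 0"
  \<comment> \<open>The margin e / 2 makes p and q positive even for null functions, so that the
    quotient below makes sense.\<close>
  define p q where "p = norm_L2 f + e / 2" and "q = norm_L2 h + e / 2"
  have pq: "p > 0" "q > 0" "norm_L2 f \<le> p" "norm_L2 h \<le> q"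
    using \<open>e > 0\<close> by (auto simp: p_def q_def add_nonneg_pos)
  \<comment> \<open>The weight that minimises (1 + t) p^2 + (1 + 1/t) q^2; the minimum is (p +
    q)^2.\<close>
  define t where "t = q / p"
  have t: "t > 0" using pq by (simp add: t_def)
  have "(norm_L2 (\<lambda>x. f x + h x))\<^sup>2
      \<le> (LINT x|lebesgue. (1 + t) * (cmod (f x))\<^sup>2 + (1 + 1 / t) * (cmod (h x))\<^sup>2)"
    unfolding norm_L2_sq
  proof (rule integral_mono)
    show "integrable lebesgue (\<lambda>x. (cmod (f x + h x))\<^sup>2)"
      by (rule L2_integrable[OF L2_add[OF assms]])
    show "integrable lebesgue (\<lambda>x. (1 + t) * (cmod (f x))\<^sup>2 + (1 + 1 / t) * (cmod (h x))\<^sup>2)"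
      using assms[THEN L2_integrable] by simp
  qed (rule cmod_add_sq_weighted[OF t])
  also have "\<dots> = (1 + t) * (norm_L2 f)\<^sup>2 + (1 + 1 / t) * (norm_L2 h)\<^sup>2"
    using assms[THEN L2_integrable] by (simp add: norm_L2_sq)
  also have "\<dots> \<le> (1 + t) * p\<^sup>2 + (1 + 1 / t) * q\<^sup>2"
    using pq t by (intro add_mono mult_left_mono power_mono) auto
  also have "\<dots> = (p + q)\<^sup>2"
  proof -
    have eqs: "t * p = q" "1 / t * q = p" using pq by (simp_all add: t_def)
    have *: "(1 + t) * p\<^sup>2 = p\<^sup>2 + (t * p) * p" "(1 + r) * q\<^sup>2 = q\<^sup>2 + (r * q) * q" for r
      by (simp_all add: power2_eq_square algebra_simps)
    show ?thesis unfolding * eqs by (simp add: power2_sum)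
  qed
  finally have "norm_L2 (\<lambda>x. f x + h x) \<le> p + q"
    by (rule power2_le_imp_le) (use pq in simp)
  then show "norm_L2 (\<lambda>x. f x + h x) \<le> norm_L2 f + norm_L2 h + e"
    by (simp add: p_def q_def)
qed

lemma norm_L2_triangle_diff:
  assumes "f \<in> L2" "h \<in> L2"
  shows "norm_L2 (\<lambda>x. f x - h x) \<le> norm_L2 f + norm_L2 h"
  using norm_L2_triangle[of f "\<lambda>x. (-1) * h x"] norm_L2_cmult[of "-1" h] L2_cmult[of h "-1"] assms
  by simp

lemma norm_L2_triangle3:
  assumes "f \<in> L2" "h \<in> L2" "k \<in> L2"
  shows "norm_L2 (\<lambda>x. f x - h x) \<le> norm_L2 (\<lambda>x. f x - k x) + norm_L2 (\<lambda>x. k x - h x)"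
  using norm_L2_triangle[of "\<lambda>x. f x - k x" "\<lambda>x. k x - h x"] assms by (simp add: L2_diff)

lemma norm_L2_le_diff:
  assumes "f \<in> L2" "h \<in> L2"
  shows "norm_L2 f \<le> norm_L2 h + norm_L2 (\<lambda>x. f x - h x)"
  using norm_L2_triangle[of h "\<lambda>x. f x - h x"] assms by (simp add: L2_diff)

lemma norm_L2_sum_le:
  assumes "\<And>m. m \<in> F \<Longrightarrow> f m \<in> L2"
  shows "norm_L2 (\<lambda>x. \<Sum>m\<in>F. f m x) \<le> (\<Sum>m\<in>F. norm_L2 (f m))"
  using assms
proof (induction F rule: infinite_finite_induct)
  case (insert m F)
  have "norm_L2 (\<lambda>x. f m x + (\<Sum>m\<in>F. f m x)) \<le> norm_L2 (f m) + norm_L2 (\<lambda>x. \<Sum>m\<in>F. f m x)"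
    using insert by (intro norm_L2_triangle L2_sum) auto
  with insert show ?case by auto
qed auto

lemma norm_L2_lincomb_le:
  assumes "\<And>m. f m \<in> L2"
  shows "norm_L2 (\<lambda>x. \<Sum>m\<in>F. c m * f m x) \<le> (\<Sum>m\<in>F. cmod (c m) * norm_L2 (f m))"
  using norm_L2_sum_le[of F "\<lambda>m x. c m * f m x"] assms
  by (auto simp: norm_L2_cmult intro: L2_cmult)

lemma norm_L2_parallelogram:
  assumes "f \<in> L2" "h \<in> L2"
  shows "(norm_L2 (\<lambda>x. f x + h x))\<^sup>2 + (norm_L2 (\<lambda>x. f x - h x))\<^sup>2
       = 2 * (norm_L2 f)\<^sup>2 + 2 * (norm_L2 h)\<^sup>2"
proof -
  have "(cmod (u + v))\<^sup>2 + (cmod (u - v))\<^sup>2 = 2 * (cmod u)\<^sup>2 + 2 * (cmod v)\<^sup>2" for u v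
    unfolding cmod_power2 by (simp add: power2_eq_square algebra_simps)
  then have "(LINT x|lebesgue. (cmod (f x + h x))\<^sup>2 + (cmod (f x - h x))\<^sup>2)
           = (LINT x|lebesgue. 2 * (cmod (f x))\<^sup>2 + 2 * (cmod (h x))\<^sup>2)"
    by simp
  moreover note L2_integrable[OF L2_add[OF assms]] L2_integrable[OF L2_diff[OF assms]]
    assms[THEN L2_integrable]
  ultimately show ?thesis by (simp add: norm_L2_sq)
qed

lemma norm_L2_sq_nn:
  assumes "f \<in> L2"
  shows "(\<integral>\<^sup>+x. ennreal ((cmod (f x))\<^sup>2) \<partial>lebesgue) = ennreal ((norm_L2 f)\<^sup>2)"
  unfolding norm_L2_sq by (rule nn_integral_eq_integral[OF L2_integrable[OF assms]]) auto

text \<open>The hypothesis concerns the nonnegative integral because a bound on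
  \<open>norm_L2\<close> could not give membership: the Bochner integral of a non-integrable square
  is 0.\<close>

lemma L2I_nn:
  assumes [measurable]: "f \<in> borel_measurable lebesgue"
    and "(\<integral>\<^sup>+x. ennreal ((cmod (f x))\<^sup>2) \<partial>lebesgue) \<le> ennreal (e\<^sup>2)" "e \<ge> 0"
  shows "f \<in> L2" "norm_L2 f \<le> e"
proof -
  show f: "f \<in> L2"
    unfolding L2_def using assms(2)
    by (auto intro!: integrableI_bounded simp: le_less_trans)
  show "norm_L2 f \<le> e"
    by (rule power2_le_imp_le) (use assms(2,3) norm_L2_sq_nn[OF f] in simp_all)
qed

text \<open>The weights \<open>2 ^ n\<close> turn rapid convergence in norm into pointwise geometric decay almost everywhere.\<close>

lemma L2_complete:
  assumes X: "\<And>n. X n \<in> L2" and step: "\<And>n. norm_L2 (\<lambda>x. X (Suc n) x - X n x) \<le> (1/2) ^ n"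
  shows "\<exists>h\<in>L2. \<forall>n. norm_L2 (\<lambda>x. X n x - h x) \<le> 2 * (1/2) ^ n"
proof -
  have [measurable]: "X n \<in> borel_measurable lebesgue" for n by (rule L2_measurable[OF X])
  define d where "d = (\<lambda>n x. X (Suc n) x - X n x)"
  have [measurable]: "d n \<in> borel_measurable lebesgue" for n unfolding d_def by measurable
  have dL: "d n \<in> L2" for n unfolding d_def by (intro L2_diff X)
  have "(\<integral>\<^sup>+x. (\<Sum>n. ennreal (2 ^ n * (cmod (d n x))\<^sup>2)) \<partial>lebesgue)
      = (\<Sum>n. \<integral>\<^sup>+x. ennreal (2 ^ n * (cmod (d n x))\<^sup>2) \<partial>lebesgue)"
    by (rule nn_integral_suminf) measurable
  also have "\<dots> = (\<Sum>n. ennreal (2 ^ n * (norm_L2 (d n))\<^sup>2))"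
    by (simp add: ennreal_mult nn_integral_cmult norm_L2_sq_nn[OF dL])
  also have "\<dots> \<le> (\<Sum>n. ennreal ((1/2) ^ n))"
  proof (rule suminf_le)
    fix n
    have "(norm_L2 (d n))\<^sup>2 \<le> ((1/2) ^ n)\<^sup>2"
      using step[of n] by (intro power_mono) (auto simp: d_def)
    then have "2 ^ n * (norm_L2 (d n))\<^sup>2 \<le> 2 ^ n * ((1/2) ^ n)\<^sup>2"
      by (intro mult_left_mono) auto
    also have "\<dots> = (1/2) ^ n"
      by (simp add: power_divide power2_eq_square)
    finally show "ennreal (2 ^ n * (norm_L2 (d n))\<^sup>2) \<le> ennreal ((1/2) ^ n)"
      by (rule ennreal_leI)
  qed auto
  also have "\<dots> < \<infinity>"
    by (subst suminf_ennreal2) (auto simp: summable_geometric)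
  finally have "AE x in lebesgue. (\<Sum>n. ennreal (2 ^ n * (cmod (d n x))\<^sup>2)) \<noteq> \<infinity>"
    by (intro nn_integral_noteq_infinite) (auto simp: less_top)
  then have conv: "AE x in lebesgue. convergent (\<lambda>n. X n x)"
  proof eventually_elim
    case (elim x)
    then have "summable (\<lambda>n. 2 ^ n * (cmod (d n x))\<^sup>2)"
      by (intro summable_suminf_not_top) auto
    then obtain C where C: "\<And>n. norm (2 ^ n * (cmod (d n x))\<^sup>2) \<le> C"
      using summable_imp_Bseq BseqE by blast
    have "C \<ge> 0" using C[of 0] norm_ge_zero order_trans by blast
    \<comment> \<open>Terms of a convergent series are bounded, so 2^n |d_n(x)|^2 \<le> C; taking
      roots gives a geometric majorant of ratio 1 / sqrt 2.\<close>
    have "norm (d n x) \<le> sqrt C * (1 / sqrt 2) ^ n" for n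
    proof (rule power2_le_imp_le)
      have *: "(sqrt C * (1 / sqrt 2) ^ n)\<^sup>2 = C / 2 ^ n"
        using \<open>C \<ge> 0\<close> by (simp add: power_mult_distrib power_divide flip: real_sqrt_power)
      then show "(norm (d n x))\<^sup>2 \<le> (sqrt C * (1 / sqrt 2) ^ n)\<^sup>2"
        using C[of n] unfolding * by (simp add: pos_le_divide_eq mult.commute)
    qed (use \<open>C \<ge> 0\<close> in auto)
    moreover have "summable (\<lambda>n. sqrt C * (1 / sqrt 2) ^ n)"
      by (intro summable_mult summable_geometric) auto
    ultimately have "summable (\<lambda>n. d n x)"
      by (blast intro: summable_comparison_test')
    then have "convergent (\<lambda>n. \<Sum>k<n. d k x)"
      by (simp add: summable_iff_convergent)
    then have "convergent (\<lambda>n. X n x - X 0 x)"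
      using sum_lessThan_telescope[of "\<lambda>k. X k x"] by (simp add: d_def)
    then show ?case
      using convergent_add[OF _ convergent_const[of "X 0 x"]] by fastforce
  qed
  \<comment> \<open>On the null set where the sequence diverges \<open>lim\<close> takes a default
    value, which affects neither measurability nor norms.\<close>
  define h where "h = (\<lambda>x. lim (\<lambda>n. X n x))"
  have [measurable]: "h \<in> borel_measurable lebesgue"
    unfolding h_def by measurable
  \<comment> \<open>The subtracted term \<open>2 * (1/2) ^ (n + k)\<close> lets the induction on k
    close with a bound uniform in k.\<close>
  have dist: "norm_L2 (\<lambda>x. X n x - X (n + k) x) \<le> 2 * (1/2) ^ n - 2 * (1/2) ^ (n + k)" for n k
  proof (induction k)
    case (Suc k)
    have "norm_L2 (\<lambda>x. X n x - X (n + Suc k) x)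
        \<le> norm_L2 (\<lambda>x. X n x - X (n + k) x) + norm_L2 (\<lambda>x. X (n + k) x - X (n + Suc k) x)"
      by (intro norm_L2_triangle3 X)
    moreover have "norm_L2 (\<lambda>x. X (n + k) x - X (n + Suc k) x) \<le> (1/2) ^ (n + k)"
      using step[of "n + k"] by (simp add: norm_L2_minus_commute)
    ultimately show ?case using Suc by simp
  qed auto
  \<comment> \<open>Fatou's lemma: the distance to the pointwise limit is at most the lower limit of
    the distances to later terms. The same bound yields membership of the limit in
    \<open>L2\<close>.\<close>
  have bound: "(\<integral>\<^sup>+x. ennreal ((cmod (X n x - h x))\<^sup>2) \<partial>lebesgue) \<le> ennreal ((2 * (1/2) ^ n)\<^sup>2)" for n
  proof -
    have "AE x in lebesgue. ennreal ((cmod (X n x - h x))\<^sup>2)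
        = liminf (\<lambda>k. ennreal ((cmod (X n x - X (n + k) x))\<^sup>2))"
      using conv
    proof eventually_elim
      case (elim x)
      then have "(\<lambda>k. X k x) \<longlonglongrightarrow> h x"
        by (simp add: h_def convergent_LIMSEQ_iff)
      then have "(\<lambda>k. X (n + k) x) \<longlonglongrightarrow> h x"
        using LIMSEQ_ignore_initial_segment[of "\<lambda>k. X k x" "h x" n] by (simp add: add.commute)
      then have "(\<lambda>k. ennreal ((cmod (X n x - X (n + k) x))\<^sup>2)) \<longlonglongrightarrow> ennreal ((cmod (X n x - h x))\<^sup>2)"
        by (intro tendsto_ennrealI tendsto_intros)
      then show ?case
        by (rule lim_imp_Liminf[OF trivial_limit_sequentially, symmetric])
    qed
    then have "(\<integral>\<^sup>+x. ennreal ((cmod (X n x - h x))\<^sup>2) \<partial>lebesgue)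
        = (\<integral>\<^sup>+x. liminf (\<lambda>k. ennreal ((cmod (X n x - X (n + k) x))\<^sup>2)) \<partial>lebesgue)"
      by (rule nn_integral_cong_AE)
    also have "\<dots> \<le> liminf (\<lambda>k. \<integral>\<^sup>+x. ennreal ((cmod (X n x - X (n + k) x))\<^sup>2) \<partial>lebesgue)"
      by (rule nn_integral_liminf) measurable
    also have "\<dots> \<le> ennreal ((2 * (1/2) ^ n)\<^sup>2)"
    proof (intro Liminf_le always_eventually allI trivial_limit_sequentially)
      fix k
      have "norm_L2 (\<lambda>x. X n x - X (n + k) x) \<le> 2 * (1/2) ^ n"
        using dist[of n k] zero_le_power[of "1/2::real" "n + k"] by linarith
      then show "(\<integral>\<^sup>+x. ennreal ((cmod (X n x - X (n + k) x))\<^sup>2) \<partial>lebesgue) \<le> ennreal ((2 * (1/2) ^ n)\<^sup>2)"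
        unfolding norm_L2_sq_nn[OF L2_diff[OF X X]] by (intro ennreal_leI power_mono) auto
    qed
    finally show ?thesis .
  qed
  have lim: "(\<lambda>x. X n x - h x) \<in> L2" "norm_L2 (\<lambda>x. X n x - h x) \<le> 2 * (1/2) ^ n" for n
    using L2I_nn[OF _ bound[of n]] by auto
  have "h \<in> L2"
    using L2_diff[OF X[of 0] lim(1)[of 0]] by simp
  with lim(2) show ?thesis by blast
qed

section \<open>Riesz inequalities on finite sums\<close>

abbreviation lincomb :: "(int \<Rightarrow> real \<Rightarrow> complex) \<Rightarrow> (int \<Rightarrow> complex) \<Rightarrow> int set \<Rightarrow> real \<Rightarrow> complex" where
  "lincomb f c F \<equiv> \<lambda>x. \<Sum>m\<in>F. c m * f m x"

text \<open>Tested on finite sums only, where convergence is no issue; A and B play the role of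
  squared Riesz basis constants.\<close>

definition riesz_bounds :: "(int \<Rightarrow> real \<Rightarrow> complex) \<Rightarrow> real \<Rightarrow> real \<Rightarrow> bool" where
  "riesz_bounds f A B \<longleftrightarrow> (\<forall>F c. finite F \<longrightarrow>
     A * (\<Sum>m\<in>F. (cmod (c m))\<^sup>2) \<le> (norm_L2 (lincomb f c F))\<^sup>2 \<and>
     (norm_L2 (lincomb f c F))\<^sup>2 \<le> B * (\<Sum>m\<in>F. (cmod (c m))\<^sup>2))"

lemma riesz_boundsD:
  assumes "riesz_bounds f A B" "finite F"
  shows "A * (\<Sum>m\<in>F. (cmod (c m))\<^sup>2) \<le> (norm_L2 (lincomb f c F))\<^sup>2"
    and "(norm_L2 (lincomb f c F))\<^sup>2 \<le> B * (\<Sum>m\<in>F. (cmod (c m))\<^sup>2)"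
  using assms by (auto simp: riesz_bounds_def)

section \<open>Unconditional sums in the seminorm\<close>

lemma has_sum_L2_iff:
  "has_sum_L2 u s \<longleftrightarrow> s \<in> L2 \<and> (\<forall>e>0. \<exists>F0. finite F0 \<and>
     (\<forall>F. finite F \<and> F0 \<subseteq> F \<longrightarrow> norm_L2 (\<lambda>x. (\<Sum>m\<in>F. u m x) - s x) < e))"
  unfolding has_sum_L2_def tendsto_iff eventually_finite_subsets_at_top by (simp add: dist_real_def)

lemma has_sum_L2E:
  assumes "has_sum_L2 u s" "e > 0"
  obtains F0 where "finite F0"
    "\<And>F. finite F \<Longrightarrow> F0 \<subseteq> F \<Longrightarrow> norm_L2 (\<lambda>x. (\<Sum>m\<in>F. u m x) - s x) < e"
proof -
  have "\<exists>F0. finite F0 \<and> (\<forall>F. finite F \<and> F0 \<subseteq> F \<longrightarrow> norm_L2 (\<lambda>x. (\<Sum>m\<in>F. u m x) - s x) < e)"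
    using assms(1)[unfolded has_sum_L2_iff] assms(2) by (elim conjE allE) (erule mp)
  then show ?thesis by (elim exE conjE) (rule that, auto)
qed

lemma lincomb_diff: "lincomb f c F x - lincomb f d F x = lincomb f (\<lambda>m. c m - d m) F x"
  by (simp add: sum_subtractf left_diff_distrib)

lemma lincomb_restrict:
  assumes "finite F" "G \<subseteq> F"
  shows "lincomb f (\<lambda>m. if m \<in> G then c m else 0) F x = lincomb f c G x"
  using assms by (intro sum.mono_neutral_cong_right) auto

lemma norm_L2_cong_diff:
  assumes "f \<in> L2" "h \<in> L2" "norm_L2 (\<lambda>x. f x - h x) = 0"
  shows "norm_L2 f = norm_L2 h"
  using norm_L2_le_diff[OF assms(1,2)] norm_L2_le_diff[OF assms(2,1)] assms(3)
  by (simp add: norm_L2_minus_commute[of h])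

lemma has_sum_L2_finite_support:
  assumes "\<And>m. f m \<in> L2" "finite F"
  shows "has_sum_L2 (\<lambda>m x. (if m \<in> F then c m else 0) * f m x) (lincomb f c F)"
  unfolding has_sum_L2_iff
proof (intro conjI allI impI exI[of _ F])
  fix e :: real and G assume "e > 0" and G: "finite G \<and> F \<subseteq> G"
  have "norm_L2 (\<lambda>x. lincomb f (\<lambda>m. if m \<in> F then c m else 0) G x - lincomb f c F x) = 0"
    using lincomb_restrict[of G F c f] G by simp
  then show "norm_L2 (\<lambda>x. lincomb f (\<lambda>m. if m \<in> F then c m else 0) G x - lincomb f c F x) < e"
    using \<open>e > 0\<close> by simp
qed (use assms in \<open>auto intro: L2_lincomb\<close>)

lemma has_sum_L2_norm_tendsto:
  assumes "has_sum_L2 u s" "\<And>m. u m \<in> L2"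
  shows "((\<lambda>F. norm_L2 (\<lambda>x. \<Sum>m\<in>F. u m x)) \<longlongrightarrow> norm_L2 s) (finite_subsets_at_top UNIV)"
proof (rule tendstoI)
  fix e :: real assume "e > 0"
  have s: "s \<in> L2" using assms(1) by (simp add: has_sum_L2_def)
  have "\<forall>\<^sub>F F in finite_subsets_at_top UNIV. dist (norm_L2 (\<lambda>x. (\<Sum>m\<in>F. u m x) - s x)) 0 < e"
    using assms(1) \<open>e > 0\<close> by (auto simp: has_sum_L2_def dest: tendstoD)
  then show "\<forall>\<^sub>F F in finite_subsets_at_top UNIV. dist (norm_L2 (\<lambda>x. \<Sum>m\<in>F. u m x)) (norm_L2 s) < e"
  proof eventually_elim
    case (elim F)
    have L: "(\<lambda>x. \<Sum>m\<in>F. u m x) \<in> L2" by (intro L2_sum assms)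
    show ?case
      using norm_L2_le_diff[OF L s] norm_L2_le_diff[OF s L] elim
      by (simp add: dist_real_def norm_L2_minus_commute[of s])
  qed
qed

lemma has_sum_L2_unique:
  assumes "has_sum_L2 u s" "has_sum_L2 u t" "\<And>m. u m \<in> L2"
  shows "norm_L2 (\<lambda>x. s x - t x) = 0"
proof -
  have st: "s \<in> L2" "t \<in> L2" using assms by (auto simp: has_sum_L2_def)
  have "((\<lambda>F. norm_L2 (\<lambda>x. (\<Sum>m\<in>F. u m x) - s x) + norm_L2 (\<lambda>x. (\<Sum>m\<in>F. u m x) - t x)) \<longlongrightarrow> 0 + 0)
          (finite_subsets_at_top UNIV)"
    using assms by (intro tendsto_add) (auto simp: has_sum_L2_def)
  moreover have "norm_L2 (\<lambda>x. s x - t x)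
      \<le> norm_L2 (\<lambda>x. (\<Sum>m\<in>F. u m x) - s x) + norm_L2 (\<lambda>x. (\<Sum>m\<in>F. u m x) - t x)" for F
    using norm_L2_triangle3[of s t "\<lambda>x. \<Sum>m\<in>F. u m x"] st L2_sum[of F u] assms(3)
    by (simp add: norm_L2_minus_commute[of s])
  ultimately have "norm_L2 (\<lambda>x. s x - t x) \<le> 0 + 0"
    by (intro tendsto_lowerbound[where F = "finite_subsets_at_top UNIV"]) auto
  then show ?thesis using norm_L2_nonneg[of "\<lambda>x. s x - t x"] by linarith
qed

lemma has_riesz_constants_imp_riesz_bounds:
  assumes f: "\<And>m. f m \<in> L2" and "A \<ge> 0" "B \<ge> 0" and "has_riesz_constants f (sqrt A) (sqrt B)"
  shows "riesz_bounds f A B"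
  unfolding riesz_bounds_def
proof (intro allI impI)
  fix F :: "int set" and c :: "int \<Rightarrow> complex" assume F: "finite F"
  \<comment> \<open>A finite sum is the sum of its zero extension; the vector s supplied by the
    definition agrees with it up to a null function.\<close>
  define d where "d = (\<lambda>m. if m \<in> F then c m else 0)"
  have "((\<lambda>m. (cmod (d m))\<^sup>2) has_sum (\<Sum>m\<in>F. (cmod (c m))\<^sup>2)) UNIV"
    by (rule has_sum_finite_neutralI[OF F]) (auto simp: d_def)
  then have d: "(\<lambda>m. (cmod (d m))\<^sup>2) summable_on UNIV"
      "(\<Sum>\<^sub>\<infinity>m. (cmod (d m))\<^sup>2) = (\<Sum>m\<in>F. (cmod (c m))\<^sup>2)"
    by (auto simp: summable_on_def infsumI)
  obtain s where s: "has_sum_L2 (\<lambda>m x. d m * f m x) s"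
     "A * (\<Sum>m\<in>F. (cmod (c m))\<^sup>2) \<le> (norm_L2 s)\<^sup>2"
     "(norm_L2 s)\<^sup>2 \<le> B * (\<Sum>m\<in>F. (cmod (c m))\<^sup>2)"
    using assms(2-4) d unfolding has_riesz_constants_def by fastforce
  have "norm_L2 (\<lambda>x. s x - lincomb f c F x) = 0"
    using s(1) has_sum_L2_finite_support[OF f F, of c] unfolding d_def
    by (rule has_sum_L2_unique) (intro L2_cmult f)
  then have "norm_L2 s = norm_L2 (lincomb f c F)"
    using s(1) by (intro norm_L2_cong_diff L2_lincomb f) (auto simp: has_sum_L2_def)
  with s show "A * (\<Sum>m\<in>F. (cmod (c m))\<^sup>2) \<le> (norm_L2 (lincomb f c F))\<^sup>2 \<and>
     (norm_L2 (lincomb f c F))\<^sup>2 \<le> B * (\<Sum>m\<in>F. (cmod (c m))\<^sup>2)"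
    by simp
qed

text \<open>The net of finite sums is first followed along the sets \<open>F0 n\<close>, a rapidly
  convergent sequence to which \<open>L2_complete\<close> applies. Its limit is the limit of the
  whole net because finite sums outside \<open>F0 n\<close> are small.\<close>

lemma has_sum_L2_of_Cauchy:
  assumes f: "\<And>m. f m \<in> L2"
    and cauchy: "\<And>e. e > 0 \<Longrightarrow> \<exists>F0. finite F0 \<and>
      (\<forall>G. finite G \<and> G \<inter> F0 = {} \<longrightarrow> norm_L2 (lincomb f c G) \<le> e)"
  shows "\<exists>s. has_sum_L2 (\<lambda>m x. c m * f m x) s"
proof -
  have "\<exists>F0. finite F0 \<and> (\<forall>G. finite G \<and> G \<inter> F0 = {} \<longrightarrow> norm_L2 (lincomb f c G) \<le> (1/2) ^ n / 2)" for n
    by (rule cauchy) simp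
  then obtain F0 where F0: "\<And>n. finite (F0 n)"
     "\<And>n G. finite G \<Longrightarrow> G \<inter> F0 n = {} \<Longrightarrow> norm_L2 (lincomb f c G) \<le> (1/2) ^ n / 2"
    by metis
  define X where "X = (\<lambda>n. lincomb f c (F0 n))"
  have XL: "X n \<in> L2" for n unfolding X_def by (intro L2_lincomb f)
  \<comment> \<open>The sets \<open>F0 n\<close> need not be nested, so consecutive sums differ by
    two set differences, each disjoint from one of the two sets.\<close>
  have split: "lincomb f c F x - lincomb f c G x = lincomb f c (F - G) x - lincomb f c (G - F) x"
    if "finite F" "finite G" for F G x
    using sum.Int_Diff[OF that(1), of "\<lambda>m. c m * f m x" G] sum.Int_Diff[OF that(2), of "\<lambda>m. c m * f m x" F]
    by (simp add: Int_commute)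
  have diff: "norm_L2 (\<lambda>x. X (Suc n) x - X n x) \<le> (1/2) ^ n" for n
  proof -
    have "norm_L2 (\<lambda>x. X (Suc n) x - X n x)
        \<le> norm_L2 (lincomb f c (F0 (Suc n) - F0 n)) + norm_L2 (lincomb f c (F0 n - F0 (Suc n)))"
      unfolding X_def split[OF F0(1) F0(1)] by (intro norm_L2_triangle_diff L2_lincomb f)
    also have "\<dots> \<le> (1/2) ^ n / 2 + (1/2) ^ Suc n / 2"
      using F0(1) by (intro add_mono F0(2)) auto
    also have "\<dots> \<le> (1/2) ^ n" by simp
    finally show ?thesis .
  qed
  obtain s where s: "s \<in> L2" "\<And>n. norm_L2 (\<lambda>x. X n x - s x) \<le> 2 * (1/2) ^ n"
    using L2_complete[of X, OF XL diff] by blast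
  have "has_sum_L2 (\<lambda>m x. c m * f m x) s"
    unfolding has_sum_L2_iff
  proof (intro conjI allI impI s(1))
    fix e :: real assume "e > 0"
    then obtain n where n: "(1/2) ^ n < e / 3"
      using real_arch_pow_inv[of "e/3" "1/2"] by auto
    show "\<exists>F0. finite F0 \<and> (\<forall>F. finite F \<and> F0 \<subseteq> F \<longrightarrow> norm_L2 (\<lambda>x. lincomb f c F x - s x) < e)"
    proof (intro exI[of _ "F0 n"] conjI F0(1) allI impI)
      fix F assume F: "finite F \<and> F0 n \<subseteq> F"
      have "norm_L2 (\<lambda>x. lincomb f c F x - s x)
          \<le> norm_L2 (\<lambda>x. lincomb f c F x - X n x) + norm_L2 (\<lambda>x. X n x - s x)"
        by (intro norm_L2_triangle3 L2_lincomb f s XL)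
      also have "(\<lambda>x. lincomb f c F x - X n x) = lincomb f c (F - F0 n)"
        using F F0(1)[of n] by (auto simp: X_def sum_diff)
      also have "norm_L2 (lincomb f c (F - F0 n)) + norm_L2 (\<lambda>x. X n x - s x)
          \<le> (1/2) ^ n / 2 + 2 * (1/2) ^ n"
        using F by (intro add_mono s F0(2)) auto
      also have "\<dots> < e" using n \<open>e > 0\<close> by simp
      finally show "norm_L2 (\<lambda>x. lincomb f c F x - s x) < e" .
    qed
  qed
  then show ?thesis by blast
qed

lemma riesz_bounds_imp_has_riesz_constants:
  assumes f: "\<And>m. f m \<in> L2" and "A \<ge> 0" "B > 0" and fb: "riesz_bounds f A B"
  shows "has_riesz_constants f (sqrt A) (sqrt B)"
  unfolding has_riesz_constants_def
proof (intro allI impI)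
  fix c :: "int \<Rightarrow> complex"
  assume summ: "(\<lambda>m. (cmod (c m))\<^sup>2) summable_on UNIV"
  define I where "I = (\<Sum>\<^sub>\<infinity>m. (cmod (c m))\<^sup>2)"
  have lim: "((\<lambda>F. \<Sum>m\<in>F. (cmod (c m))\<^sup>2) \<longlongrightarrow> I) (finite_subsets_at_top UNIV)"
    using has_sum_infsum[OF summ] by (simp add: has_sum_def I_def)
  have "\<exists>s. has_sum_L2 (\<lambda>m x. c m * f m x) s"
  proof (rule has_sum_L2_of_Cauchy[OF f])
    fix e :: real assume "e > 0"
    \<comment> \<open>A finite sum of squares disjoint from F0 is a difference of two partial sums
      within \<delta> of I, hence at most 2 \<delta>; the upper inequality turns this into
      e^2.\<close>
    define \<delta> where "\<delta> = e\<^sup>2 / (2 * B)"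
    have "\<delta> > 0" using \<open>e > 0\<close> \<open>B > 0\<close> by (simp add: \<delta>_def)
    then obtain F0 where F0: "finite F0"
       "\<And>F. finite F \<Longrightarrow> F0 \<subseteq> F \<Longrightarrow> \<bar>(\<Sum>m\<in>F. (cmod (c m))\<^sup>2) - I\<bar> < \<delta>"
      using tendstoD[OF lim] unfolding eventually_finite_subsets_at_top dist_real_def by force
    show "\<exists>F0. finite F0 \<and> (\<forall>G. finite G \<and> G \<inter> F0 = {} \<longrightarrow> norm_L2 (lincomb f c G) \<le> e)"
    proof (intro exI[of _ F0] conjI F0(1) allI impI)
      fix G assume G: "finite G \<and> G \<inter> F0 = {}"
      have "(\<Sum>m\<in>G \<union> F0. (cmod (c m))\<^sup>2) = (\<Sum>m\<in>G. (cmod (c m))\<^sup>2) + (\<Sum>m\<in>F0. (cmod (c m))\<^sup>2)"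
        using G F0(1) by (intro sum.union_disjoint) auto
      then have "(\<Sum>m\<in>G. (cmod (c m))\<^sup>2) \<le> 2 * \<delta>"
        using F0(2)[of "G \<union> F0"] F0(2)[of F0] F0(1) G by simp
      then have "B * (\<Sum>m\<in>G. (cmod (c m))\<^sup>2) \<le> B * (2 * \<delta>)"
        using \<open>B > 0\<close> by simp
      also have "\<dots> = e\<^sup>2" using \<open>B > 0\<close> by (simp add: \<delta>_def)
      finally have "(norm_L2 (lincomb f c G))\<^sup>2 \<le> e\<^sup>2"
        using riesz_boundsD(2)[OF fb, of G c] G by linarith
      then show "norm_L2 (lincomb f c G) \<le> e"
        by (rule power2_le_imp_le) (use \<open>e > 0\<close> in simp)
    qed
  qed
  then obtain s where s: "has_sum_L2 (\<lambda>m x. c m * f m x) s" ..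
  have N: "((\<lambda>F. (norm_L2 (lincomb f c F))\<^sup>2) \<longlongrightarrow> (norm_L2 s)\<^sup>2) (finite_subsets_at_top UNIV)"
    by (intro tendsto_power has_sum_L2_norm_tendsto s L2_cmult f)
  have "A * I \<le> (norm_L2 s)\<^sup>2"
    by (rule tendsto_le[OF _ N tendsto_mult_left[OF lim]])
       (auto intro!: eventually_finite_subsets_at_top_weakI riesz_boundsD(1)[OF fb])
  moreover have "(norm_L2 s)\<^sup>2 \<le> B * I"
    by (rule tendsto_le[OF _ tendsto_mult_left[OF lim] N])
       (auto intro!: eventually_finite_subsets_at_top_weakI riesz_boundsD(2)[OF fb])
  ultimately show "\<exists>s. has_sum_L2 (\<lambda>m x. c m * f m x) s \<and>
      (sqrt A)\<^sup>2 * (\<Sum>\<^sub>\<infinity>m. (cmod (c m))\<^sup>2) \<le> (norm_L2 s)\<^sup>2 \<and>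
      (norm_L2 s)\<^sup>2 \<le> (sqrt B)\<^sup>2 * (\<Sum>\<^sub>\<infinity>m. (cmod (c m))\<^sup>2)"
    using s assms(2,3) by (auto simp: I_def)
qed

text \<open>The lower inequality makes every coordinate a bounded functional on finite sums, with
  bound 1 / sqrt A. Both uniqueness and convergence of coefficients rest on this.\<close>

lemma riesz_bounds_coeff_le:
  assumes "riesz_bounds f A B" "A > 0" "finite F" "m \<in> F"
  shows "cmod (c m) \<le> norm_L2 (lincomb f c F) / sqrt A"
proof (rule power2_le_imp_le)
  have "(cmod (c m))\<^sup>2 \<le> (\<Sum>m\<in>F. (cmod (c m))\<^sup>2)"
    using assms(3,4) by (intro member_le_sum) auto
  then have "A * (cmod (c m))\<^sup>2 \<le> (norm_L2 (lincomb f c F))\<^sup>2"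
    using riesz_boundsD(1)[OF assms(1,3), of c] assms(2) mult_left_mono[of _ _ A]
    by (meson less_imp_le order_trans)
  then show "(cmod (c m))\<^sup>2 \<le> (norm_L2 (lincomb f c F) / sqrt A)\<^sup>2"
    using assms(2) by (simp add: power_divide field_simps)
qed (use assms(2) in simp)

lemma riesz_bounds_expansion_unique:
  assumes f: "\<And>m. f m \<in> L2" and "A > 0" and fb: "riesz_bounds f A B"
    and c: "has_sum_L2 (\<lambda>m x. c m * f m x) h" and d: "has_sum_L2 (\<lambda>m x. d m * f m x) h"
  shows "c = d"
proof
  fix m
  have hL: "h \<in> L2" using c by (simp add: has_sum_L2_def)
  have "cmod (c m - d m) \<le> e" if "e > 0" for e
  proof -
    have "e * sqrt A / 2 > 0" using that \<open>A > 0\<close> by simp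
    note pos = this
    obtain F1 where F1: "finite F1"
      "\<And>F. finite F \<Longrightarrow> F1 \<subseteq> F \<Longrightarrow> norm_L2 (\<lambda>x. lincomb f c F x - h x) < e * sqrt A / 2"
      by (rule has_sum_L2E[OF c pos]) (rule that)
    obtain F2 where F2: "finite F2"
      "\<And>F. finite F \<Longrightarrow> F2 \<subseteq> F \<Longrightarrow> norm_L2 (\<lambda>x. lincomb f d F x - h x) < e * sqrt A / 2"
      by (rule has_sum_L2E[OF d pos]) (rule that)
    define F where "F = insert m (F1 \<union> F2)"
    have fin: "finite F" using F1 F2 by (simp add: F_def)
    have "norm_L2 (lincomb f (\<lambda>m. c m - d m) F)
        \<le> norm_L2 (\<lambda>x. lincomb f c F x - h x) + norm_L2 (\<lambda>x. h x - lincomb f d F x)"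
      unfolding lincomb_diff[symmetric] by (intro norm_L2_triangle3 L2_lincomb f hL)
    also have "\<dots> \<le> e * sqrt A"
      using F1(2)[OF fin] F2(2)[OF fin] norm_L2_minus_commute[of h "lincomb f d F"]
      by (simp add: F_def subset_insertI2)
    finally have "norm_L2 (lincomb f (\<lambda>m. c m - d m) F) / sqrt A \<le> e"
      using \<open>A > 0\<close> by (simp add: field_simps)
    then show ?thesis
      using riesz_bounds_coeff_le[OF fb \<open>A > 0\<close> fin, of m "\<lambda>m. c m - d m"] by (simp add: F_def)
  qed
  then have "cmod (c m - d m) \<le> 0" by (rule field_le_epsilon) simp
  then show "c m = d m" by simp
qed

text \<open>The coefficients of approximants of h are Cauchy by the lower inequality; the upper
  inequality then turns square-sum closeness to the limiting coefficients back into closeness in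
  norm.\<close>

lemma riesz_bounds_expansion_exists:
  assumes f: "\<And>m. f m \<in> L2" and "A > 0" "B > 0" and fb: "riesz_bounds f A B"
    and h: "h \<in> closed_span_L2 f"
  shows "\<exists>c. has_sum_L2 (\<lambda>m x. c m * f m x) h"
proof -
  have hL: "h \<in> L2" using h by (simp add: closed_span_L2_def)
  have "\<exists>F c. finite F \<and> norm_L2 (\<lambda>x. h x - lincomb f c F x) < 1 / real (Suc k)" for k
    using h unfolding closed_span_L2_def by (simp del: of_nat_Suc)
  then obtain F0 c0 where F0: "\<And>k. finite (F0 k)"
     "\<And>k. norm_L2 (\<lambda>x. h x - lincomb f (c0 k) (F0 k) x) < 1 / real (Suc k)"
    by metis
  define c where "c = (\<lambda>k m. if m \<in> F0 k then c0 k m else 0)"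
  have c: "norm_L2 (\<lambda>x. h x - lincomb f (c k) F x) < 1 / real (Suc k)" if "finite F" "F0 k \<subseteq> F" for k F
    using lincomb_restrict[OF that, of "c0 k" f] F0(2)[of k] by (simp add: c_def)
  have close: "norm_L2 (lincomb f (\<lambda>m. c k m - c l m) F) \<le> 1 / real (Suc k) + 1 / real (Suc l)"
    if "finite F" "F0 k \<union> F0 l \<subseteq> F" for k l F
  proof -
    have "norm_L2 (lincomb f (\<lambda>m. c k m - c l m) F)
        \<le> norm_L2 (\<lambda>x. lincomb f (c k) F x - h x) + norm_L2 (\<lambda>x. h x - lincomb f (c l) F x)"
      unfolding lincomb_diff[symmetric] by (intro norm_L2_triangle3 L2_lincomb f hL)
    then show ?thesis
      using c[OF that(1), of k] c[OF that(1), of l] that(2)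
      by (simp add: norm_L2_minus_commute[of "lincomb f (c k) F"])
  qed
  have "Cauchy (\<lambda>k. c k m)" for m
  proof (rule CauchyI)
    fix e :: real assume "e > 0"
    then obtain K where K: "1 / real (Suc K) < e * sqrt A / 2"
      using \<open>A > 0\<close> nat_approx_posE[of "e * sqrt A / 2"] by auto
    show "\<exists>M. \<forall>k\<ge>M. \<forall>l\<ge>M. norm (c k m - c l m) < e"
    proof (intro exI[of _ K] allI impI)
      fix k l assume kl: "K \<le> k" "K \<le> l"
      define F where "F = insert m (F0 k \<union> F0 l)"
      have fin: "finite F" using F0(1) by (simp add: F_def)
      have "1 / real (Suc k) \<le> 1 / real (Suc K)" "1 / real (Suc l) \<le> 1 / real (Suc K)"
        using kl by (simp_all add: frac_le)
      then have "norm_L2 (lincomb f (\<lambda>m. c k m - c l m) F) < e * sqrt A"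
        using close[OF fin, of k l] K by (simp add: F_def subset_insertI)
      then have "norm_L2 (lincomb f (\<lambda>m. c k m - c l m) F) / sqrt A < e"
        using \<open>A > 0\<close> by (simp add: field_simps)
      then show "norm (c k m - c l m) < e"
        using riesz_bounds_coeff_le[OF fb \<open>A > 0\<close> fin, of m "\<lambda>m. c k m - c l m"] by (simp add: F_def)
    qed
  qed
  then have "\<exists>d. (\<lambda>k. c k m) \<longlonglongrightarrow> d" for m
    using Cauchy_convergent convergent_def by blast
  then obtain d where d: "\<And>m. (\<lambda>k. c k m) \<longlonglongrightarrow> d m" by metis
  \<comment> \<open>The bound is uniform in F: comparing stages k and l on a common index set and
    letting l grow gives square-sum distance at most 1 / (A (k+1)^2) on every finite set.\<close>
  have near: "norm_L2 (lincomb f (\<lambda>m. c k m - d m) F) \<le> sqrt (B / A) * (1 / real (Suc k))"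
    if fin: "finite F" for k F
  proof -
    have "(\<Sum>m\<in>F. (cmod (c k m - c l m))\<^sup>2) \<le> (1 / real (Suc k) + 1 / real (Suc l))\<^sup>2 / A" for l
    proof -
      define G where "G = F \<union> (F0 k \<union> F0 l)"
      have G: "finite G" "F0 k \<union> F0 l \<subseteq> G" "F \<subseteq> G" using fin F0(1) by (auto simp: G_def)
      have "A * (\<Sum>m\<in>F. (cmod (c k m - c l m))\<^sup>2) \<le> A * (\<Sum>m\<in>G. (cmod (c k m - c l m))\<^sup>2)"
        using G \<open>A > 0\<close> by (intro mult_left_mono sum_mono2) auto
      also have "\<dots> \<le> (norm_L2 (lincomb f (\<lambda>m. c k m - c l m) G))\<^sup>2"
        using riesz_boundsD(1)[OF fb G(1), of "\<lambda>m. c k m - c l m"] .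
      also have "\<dots> \<le> (1 / real (Suc k) + 1 / real (Suc l))\<^sup>2"
        by (intro power_mono close G norm_L2_nonneg)
      finally show ?thesis using \<open>A > 0\<close> by (simp add: pos_le_divide_eq mult.commute)
    qed
    moreover have "(\<lambda>l. \<Sum>m\<in>F. (cmod (c k m - c l m))\<^sup>2) \<longlonglongrightarrow> (\<Sum>m\<in>F. (cmod (c k m - d m))\<^sup>2)"
      by (intro tendsto_intros d)
    moreover have "(\<lambda>l. (1 / real (Suc k) + 1 / real (Suc l))\<^sup>2 / A) \<longlonglongrightarrow> (1 / real (Suc k) + 0)\<^sup>2 / A"
      using LIMSEQ_inverse_real_of_nat \<open>A > 0\<close>
      by (intro tendsto_intros) (auto simp: inverse_eq_divide)
    ultimately have "(\<Sum>m\<in>F. (cmod (c k m - d m))\<^sup>2) \<le> (1 / real (Suc k) + 0)\<^sup>2 / A"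
      by (intro LIMSEQ_le) auto
    then have "B * (\<Sum>m\<in>F. (cmod (c k m - d m))\<^sup>2) \<le> B * ((1 / real (Suc k) + 0)\<^sup>2 / A)"
      using \<open>B > 0\<close> by (intro mult_left_mono) auto
    also have "\<dots> = (sqrt (B / A) * (1 / real (Suc k)))\<^sup>2"
      using \<open>A > 0\<close> \<open>B > 0\<close> by (simp add: power_mult_distrib power_divide del: of_nat_Suc)
    finally have "(norm_L2 (lincomb f (\<lambda>m. c k m - d m) F))\<^sup>2 \<le> (sqrt (B / A) * (1 / real (Suc k)))\<^sup>2"
      using riesz_boundsD(2)[OF fb fin, of "\<lambda>m. c k m - d m"] by linarith
    then show ?thesis
      by (rule power2_le_imp_le) (use \<open>A > 0\<close> \<open>B > 0\<close> in simp)
  qed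
  have "has_sum_L2 (\<lambda>m x. d m * f m x) h"
    unfolding has_sum_L2_iff
  proof (intro conjI allI impI hL)
    fix e :: real assume "e > 0"
    define r where "r = sqrt (B / A) + 1"
    have "r > 0" using \<open>A > 0\<close> \<open>B > 0\<close> by (simp add: r_def add_nonneg_pos)
    then obtain k where "1 / real (Suc k) < e / r"
      using \<open>e > 0\<close> nat_approx_posE[of "e / r"] by auto
    then have k: "r * (1 / real (Suc k)) < e"
      using \<open>r > 0\<close> by (simp add: field_simps)
    show "\<exists>F0. finite F0 \<and> (\<forall>F. finite F \<and> F0 \<subseteq> F \<longrightarrow> norm_L2 (\<lambda>x. lincomb f d F x - h x) < e)"
    proof (intro exI[of _ "F0 k"] conjI F0(1) allI impI)
      fix F assume F: "finite F \<and> F0 k \<subseteq> F"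
      have "norm_L2 (\<lambda>x. h x - lincomb f d F x)
          \<le> norm_L2 (\<lambda>x. h x - lincomb f (c k) F x) + norm_L2 (\<lambda>x. lincomb f (c k) F x - lincomb f d F x)"
        by (intro norm_L2_triangle3 L2_lincomb f hL)
      also have "\<dots> \<le> 1 / real (Suc k) + sqrt (B / A) * (1 / real (Suc k))"
        unfolding lincomb_diff using F by (intro add_mono near less_imp_le[OF c]) auto
      also have "\<dots> = r * (1 / real (Suc k))"
        by (simp add: r_def distrib_right add_divide_distrib)
      finally show "norm_L2 (\<lambda>x. lincomb f d F x - h x) < e"
        using k norm_L2_minus_commute[of h "lincomb f d F"] by linarith
    qed
  qed
  then show ?thesis by blast
qed

lemma lincomb_in_closed_span:
  assumes "\<And>m. f m \<in> L2" "finite F"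
  shows "lincomb f c F \<in> closed_span_L2 f"
  unfolding closed_span_L2_def
  using assms by (auto intro!: L2_lincomb exI[of _ F] exI[of _ c])

lemma member_closed_span: "(\<And>m. f m \<in> L2) \<Longrightarrow> f k \<in> closed_span_L2 f"
  using lincomb_in_closed_span[of f "{k}" "\<lambda>_. 1"] by simp

lemma riesz_bounds_imp_riesz_basic_sequence:
  assumes f: "\<And>m. f m \<in> L2" and "A > 0" "B > 0" and fb: "riesz_bounds f A B"
  shows "riesz_basic_sequence f"
  unfolding riesz_basic_sequence_def riesz_basis_def unconditional_basis_def
proof (intro conjI allI ballI f member_closed_span)
  fix h assume "h \<in> closed_span_L2 f"
  from riesz_bounds_expansion_exists[OF f assms(2-4) this]
    riesz_bounds_expansion_unique[OF f \<open>A > 0\<close> fb]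
  show "\<exists>!c. has_sum_L2 (\<lambda>m x. c m * f m x) h"
    by blast
next
  have "A \<le> (norm_L2 (f m))\<^sup>2 \<and> (norm_L2 (f m))\<^sup>2 \<le> B" for m
    using riesz_boundsD[OF fb, of "{m}" "\<lambda>_. 1"] by simp
  then have "sqrt A \<le> norm_L2 (f m) \<and> norm_L2 (f m) \<le> sqrt B" for m
    by (simp add: real_le_lsqrt real_le_rsqrt real_sqrt_le_iff' abs_le_square_iff)
  then show "\<exists>\<alpha>>0. \<exists>\<beta>. \<forall>m. \<alpha> \<le> norm_L2 (f m) \<and> norm_L2 (f m) \<le> \<beta>"
    using \<open>A > 0\<close> by (intro exI[of _ "sqrt A"] exI[of _ "sqrt B"]) auto
qed

section \<open>Bounded unconditional bases satisfy Riesz inequalities\<close>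

lemma has_sum_L2_add:
  assumes u: "\<And>m. u m \<in> L2" and v: "\<And>m. v m \<in> L2" and s: "has_sum_L2 u s" and t: "has_sum_L2 v t"
  shows "has_sum_L2 (\<lambda>m x. u m x + v m x) (\<lambda>x. s x + t x)"
proof -
  have st: "s \<in> L2" "t \<in> L2" using s t by (auto simp: has_sum_L2_def)
  let ?b = "\<lambda>F. norm_L2 (\<lambda>x. (\<Sum>m\<in>F. u m x) - s x) + norm_L2 (\<lambda>x. (\<Sum>m\<in>F. v m x) - t x)"
  have lim: "(?b \<longlongrightarrow> 0) (finite_subsets_at_top UNIV)"
    using tendsto_add[of _ 0 _ _ 0] s t unfolding has_sum_L2_def by fastforce
  have "norm_L2 (\<lambda>x. ((\<Sum>m\<in>F. u m x) - s x) + ((\<Sum>m\<in>F. v m x) - t x)) \<le> ?b F" for F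
    by (intro norm_L2_triangle L2_diff L2_sum u v st)
  then have "\<forall>\<^sub>F F in finite_subsets_at_top UNIV. norm_L2 (\<lambda>x. (\<Sum>m\<in>F. u m x + v m x) - (s x + t x)) \<le> ?b F"
    by (intro always_eventually allI) (simp add: sum.distrib algebra_simps)
  then have "((\<lambda>F. norm_L2 (\<lambda>x. (\<Sum>m\<in>F. u m x + v m x) - (s x + t x))) \<longlongrightarrow> 0)
      (finite_subsets_at_top UNIV)"
    by (rule tendsto_sandwich[OF _ _ tendsto_const lim, rotated]) simp
  then show ?thesis unfolding has_sum_L2_def using L2_add[OF st] by simp
qed

lemma has_sum_L2_cmult:
  assumes "has_sum_L2 u s"
  shows "has_sum_L2 (\<lambda>m x. a * u m x) (\<lambda>x. a * s x)"
proof -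
  have *: "norm_L2 (\<lambda>x. (\<Sum>m\<in>F. a * u m x) - a * s x) = cmod a * norm_L2 (\<lambda>x. (\<Sum>m\<in>F. u m x) - s x)" for F
    using norm_L2_cmult[of a "\<lambda>x. (\<Sum>m\<in>F. u m x) - s x"] by (simp add: sum_distrib_left right_diff_distrib)
  show ?thesis
    using assms tendsto_mult_left[of _ 0 _ "cmod a"] unfolding has_sum_L2_def *
    by (auto intro: L2_cmult)
qed

lemma has_sum_L2_in_closed_span:
  assumes "has_sum_L2 (\<lambda>m x. c m * f m x) h"
  shows "h \<in> closed_span_L2 f"
proof -
  have "\<exists>F c. finite F \<and> norm_L2 (\<lambda>x. h x - lincomb f c F x) < e" if pos: "e > 0" for e
  proof -
    obtain F0 where "finite F0" "norm_L2 (\<lambda>x. lincomb f c F0 x - h x) < e"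
      using has_sum_L2E[OF assms pos] by (metis order_refl)
    then show ?thesis using norm_L2_minus_commute[of h "lincomb f c F0"]
      by (intro exI[of _ F0] exI[of _ c]) simp
  qed
  then show ?thesis using assms by (simp add: closed_span_L2_def has_sum_L2_def)
qed

lemma closed_span_L2_L2: "h \<in> closed_span_L2 f \<Longrightarrow> h \<in> L2"
  by (simp add: closed_span_L2_def)

lemma closed_span_L2_limit:
  assumes f: "\<And>m. f m \<in> L2" and h: "h \<in> L2"
    and k: "\<And>e. e > 0 \<Longrightarrow> \<exists>k\<in>closed_span_L2 f. norm_L2 (\<lambda>x. h x - k x) < e"
  shows "h \<in> closed_span_L2 f"
  unfolding closed_span_L2_def
proof (intro CollectI conjI allI impI h)
  fix e :: real assume "e > 0"
  then obtain k where k: "k \<in> closed_span_L2 f" "norm_L2 (\<lambda>x. h x - k x) < e / 2"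
    using k[of "e/2"] by auto
  then obtain F c where F: "finite F" "norm_L2 (\<lambda>x. k x - lincomb f c F x) < e / 2"
    using \<open>e > 0\<close> unfolding closed_span_L2_def by (auto dest: spec[of _ "e/2"])
  have "norm_L2 (\<lambda>x. h x - lincomb f c F x) < e"
    using norm_L2_triangle3[OF h L2_lincomb closed_span_L2_L2[OF k(1)], of f c F, OF f] k(2) F(2) by simp
  with F show "\<exists>F c. finite F \<and> norm_L2 (\<lambda>x. h x - lincomb f c F x) < e" by blast
qed

lemma closed_span_L2_cmult:
  assumes "h \<in> closed_span_L2 f"
  shows "(\<lambda>x. a * h x) \<in> closed_span_L2 f"
  unfolding closed_span_L2_def
proof (intro CollectI conjI allI impI)
  fix e :: real assume "e > 0"
  \<comment> \<open>The summand 1 covers the case a = 0.\<close>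
  then have "e / (cmod a + 1) > 0" by (simp add: add_nonneg_pos)
  then obtain F c where F: "finite F" "norm_L2 (\<lambda>x. h x - lincomb f c F x) < e / (cmod a + 1)"
    using assms unfolding closed_span_L2_def by blast
  have "norm_L2 (\<lambda>x. a * h x - lincomb f (\<lambda>m. a * c m) F x) = cmod a * norm_L2 (\<lambda>x. h x - lincomb f c F x)"
    using norm_L2_cmult[of a "\<lambda>x. h x - lincomb f c F x"]
    by (simp add: sum_distrib_left right_diff_distrib mult.assoc)
  also have "\<dots> \<le> cmod a * (e / (cmod a + 1))" using F by (intro mult_left_mono) auto
  also have "\<dots> < e"
  proof -
    have "cmod a / (cmod a + 1) < 1" by (simp add: divide_less_eq_1 add_nonneg_pos)
    from mult_strict_left_mono[OF this \<open>e > 0\<close>] show ?thesis by (simp add: mult.commute)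
  qed
  finally show "\<exists>F c. finite F \<and> norm_L2 (\<lambda>x. a * h x - lincomb f c F x) < e"
    using F(1) by (intro exI[of _ F] exI[of _ "\<lambda>m. a * c m"]) simp
qed (use assms in \<open>auto intro: L2_cmult closed_span_L2_L2\<close>)

lemma closed_span_L2_add:
  assumes f: "\<And>m. f m \<in> L2" and h: "h \<in> closed_span_L2 f" and k: "k \<in> closed_span_L2 f"
  shows "(\<lambda>x. h x + k x) \<in> closed_span_L2 f"
  unfolding closed_span_L2_def
proof (intro CollectI conjI allI impI)
  fix e :: real assume "e > 0"
  then have "e / 2 > 0" by simp
  obtain F c where F: "finite F" "norm_L2 (\<lambda>x. h x - lincomb f c F x) < e / 2"
    using h \<open>e / 2 > 0\<close> unfolding closed_span_L2_def by blast
  obtain G d where G: "finite G" "norm_L2 (\<lambda>x. k x - lincomb f d G x) < e / 2"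
    using k \<open>e / 2 > 0\<close> unfolding closed_span_L2_def by blast
  define b where "b = (\<lambda>m. (if m \<in> F then c m else 0) + (if m \<in> G then d m else 0))"
  have b: "lincomb f b (F \<union> G) x = lincomb f c F x + lincomb f d G x" for x
    using lincomb_restrict[of "F \<union> G" F c f x] lincomb_restrict[of "F \<union> G" G d f x] F G
    by (simp add: b_def distrib_right sum.distrib)
  have "norm_L2 (\<lambda>x. (h x - lincomb f c F x) + (k x - lincomb f d G x)) < e"
    using norm_L2_triangle[of "\<lambda>x. h x - lincomb f c F x" "\<lambda>x. k x - lincomb f d G x"] F G
      L2_diff[OF closed_span_L2_L2[OF h] L2_lincomb, of f c F, OF f]
      L2_diff[OF closed_span_L2_L2[OF k] L2_lincomb, of f d G, OF f] by simp
  then have "norm_L2 (\<lambda>x. (h x + k x) - lincomb f b (F \<union> G) x) < e"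
    unfolding b by (simp add: algebra_simps)
  then show "\<exists>F c. finite F \<and> norm_L2 (\<lambda>x. (h x + k x) - lincomb f c F x) < e"
    using F(1) G(1) by blast
qed (use h k in \<open>auto intro: L2_add closed_span_L2_L2\<close>)

lemma closed_span_L2_diff:
  assumes "\<And>m. f m \<in> L2" "h \<in> closed_span_L2 f" "k \<in> closed_span_L2 f"
  shows "(\<lambda>x. h x - k x) \<in> closed_span_L2 f"
  using closed_span_L2_add[OF assms(1,2) closed_span_L2_cmult[OF assms(3), of "-1"]] by simp

text \<open>The ball of radius s for the gauge formed by the supremum of the norms of all finite
  partial sums. Only some coefficient sequence is asked for, so these balls add and scale without
  appeal to uniqueness of expansions.\<close>

definition expands_le :: "(int \<Rightarrow> real \<Rightarrow> complex) \<Rightarrow> real \<Rightarrow> (real \<Rightarrow> complex) \<Rightarrow> bool" where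
  "expands_le f s h \<longleftrightarrow> (\<exists>c. has_sum_L2 (\<lambda>m x. c m * f m x) h \<and>
     (\<forall>F. finite F \<longrightarrow> norm_L2 (lincomb f c F) \<le> s))"

lemma expands_le_L2: "expands_le f s h \<Longrightarrow> h \<in> L2"
  by (auto simp: expands_le_def has_sum_L2_def)

lemma expands_le_closed_span: "expands_le f s h \<Longrightarrow> h \<in> closed_span_L2 f"
  by (auto simp: expands_le_def intro: has_sum_L2_in_closed_span)

lemma expands_le_cmult:
  assumes "expands_le f s h"
  shows "expands_le f (cmod a * s) (\<lambda>x. a * h x)"
proof -
  obtain c where c: "has_sum_L2 (\<lambda>m x. c m * f m x) h" "\<And>F. finite F \<Longrightarrow> norm_L2 (lincomb f c F) \<le> s"
    using assms by (auto simp: expands_le_def)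
  have "norm_L2 (lincomb f (\<lambda>m. a * c m) F) \<le> cmod a * s" if "finite F" for F
    using norm_L2_cmult[of a "lincomb f c F"] c(2)[OF that]
    by (simp add: sum_distrib_left mult.assoc mult_left_mono)
  moreover have "has_sum_L2 (\<lambda>m x. (a * c m) * f m x) (\<lambda>x. a * h x)"
    using has_sum_L2_cmult[OF c(1), of a] by (simp add: mult.assoc)
  ultimately show ?thesis unfolding expands_le_def by (intro exI[of _ "\<lambda>m. a * c m"]) auto
qed

lemma expands_le_add:
  assumes f: "\<And>m. f m \<in> L2" and "expands_le f s h" "expands_le f t k"
  shows "expands_le f (s + t) (\<lambda>x. h x + k x)"
proof -
  obtain c where c: "has_sum_L2 (\<lambda>m x. c m * f m x) h" "\<And>F. finite F \<Longrightarrow> norm_L2 (lincomb f c F) \<le> s"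
    using assms(2) by (auto simp: expands_le_def)
  obtain d where d: "has_sum_L2 (\<lambda>m x. d m * f m x) k" "\<And>F. finite F \<Longrightarrow> norm_L2 (lincomb f d F) \<le> t"
    using assms(3) by (auto simp: expands_le_def)
  have "norm_L2 (lincomb f (\<lambda>m. c m + d m) F) \<le> s + t" if "finite F" for F
    using norm_L2_triangle[of "lincomb f c F" "lincomb f d F", OF L2_lincomb L2_lincomb, OF f f]
      c(2)[OF that] d(2)[OF that] by (simp add: distrib_right sum.distrib)
  moreover have "has_sum_L2 (\<lambda>m x. (c m + d m) * f m x) (\<lambda>x. h x + k x)"
    using has_sum_L2_add[OF L2_cmult L2_cmult c(1) d(1), OF f f] by (simp add: distrib_right)
  ultimately show ?thesis unfolding expands_le_def by (intro exI[of _ "\<lambda>m. c m + d m"]) auto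
qed

lemma expands_le_diff:
  assumes "\<And>m. f m \<in> L2" "expands_le f s h" "expands_le f t k"
  shows "expands_le f (s + t) (\<lambda>x. h x - k x)"
  using expands_le_add[OF assms(1,2) expands_le_cmult[OF assms(3), of "-1"]] by simp

text \<open>Convergence controls only finite sets containing F0. An arbitrary F is reached by
  subtracting the sum over F0 - F from the one over F \<union> F0, and the subtracted sums have a
  bound depending on F0 alone.\<close>

lemma has_sum_L2_imp_expands_le:
  assumes f: "\<And>m. f m \<in> L2" and h: "has_sum_L2 (\<lambda>m x. c m * f m x) h"
  shows "\<exists>s. expands_le f s h"
proof -
  have hL: "h \<in> L2" using h by (simp add: has_sum_L2_def)
  obtain F0 where F0: "finite F0"
     "\<And>F. finite F \<Longrightarrow> F0 \<subseteq> F \<Longrightarrow> norm_L2 (\<lambda>x. lincomb f c F x - h x) < 1"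
    by (rule has_sum_L2E[OF h zero_less_one]) (rule that)
  define s where "s = norm_L2 h + 1 + (\<Sum>m\<in>F0. cmod (c m) * norm_L2 (f m))"
  have "norm_L2 (lincomb f c F) \<le> s" if F: "finite F" for F
  proof -
    have "lincomb f c F x = lincomb f c (F \<union> F0) x - lincomb f c (F0 - F) x" for x
      using sum.union_disjoint[of F "F0 - F" "\<lambda>m. c m * f m x"] F F0(1) by simp
    then have "norm_L2 (lincomb f c F) \<le> norm_L2 (lincomb f c (F \<union> F0)) + norm_L2 (lincomb f c (F0 - F))"
      using norm_L2_triangle_diff[of "lincomb f c (F \<union> F0)" "lincomb f c (F0 - F)", OF L2_lincomb L2_lincomb, OF f f]
      by simp
    moreover have "norm_L2 (lincomb f c (F \<union> F0)) \<le> norm_L2 h + 1"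
      using norm_L2_le_diff[OF L2_lincomb hL, of f c "F \<union> F0", OF f] F0(2)[of "F \<union> F0"] F F0(1) by simp
    moreover have "norm_L2 (lincomb f c (F0 - F)) \<le> (\<Sum>m\<in>F0. cmod (c m) * norm_L2 (f m))"
      by (rule order_trans[OF norm_L2_lincomb_le[OF f] sum_mono2]) (use F0 in auto)
    ultimately show ?thesis by (simp add: s_def)
  qed
  with h show ?thesis by (auto simp: expands_le_def)
qed

text \<open>Baire category argument by hand: the closed span is complete and is the union of the sets
  \<open>{z. expands_le f n z}\<close>, so one of these is dense in some ball.\<close>

lemma expands_le_dense_in_ball:
  assumes f: "\<And>m. f m \<in> L2" and ex: "\<And>h. h \<in> closed_span_L2 f \<Longrightarrow> \<exists>c. has_sum_L2 (\<lambda>m x. c m * f m x) h"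
  shows "\<exists>n::nat. \<exists>x\<in>closed_span_L2 f. \<exists>r>0. \<forall>y\<in>closed_span_L2 f. norm_L2 (\<lambda>t. y t - x t) < r \<longrightarrow>
    (\<forall>e>0. \<exists>z. expands_le f (real n) z \<and> norm_L2 (\<lambda>t. y t - z t) < e)"
proof (rule ccontr)
  let ?H = "closed_span_L2 f"
  assume "\<not> ?thesis"
  then have neg: "\<exists>y\<in>?H. norm_L2 (\<lambda>t. y t - x t) < r \<and>
      (\<exists>e>0. \<forall>z. expands_le f (real n) z \<longrightarrow> e \<le> norm_L2 (\<lambda>t. y t - z t))" if "x \<in> ?H" "r > 0" for n x r
    using that unfolding not_less[symmetric] by blast
  \<comment> \<open>A stage is a centre together with a radius; \<open>Q\<close> keeps the next
    closed ball inside the present one and strictly away from the n-th level set.\<close>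
  define P where "P = (\<lambda>n (x, r :: real). x \<in> ?H \<and> 0 < r \<and> r \<le> (1/2) ^ n)"
  define Q where "Q = (\<lambda>n (x, r :: real) (y, r'). norm_L2 (\<lambda>t. y t - x t) + r' \<le> r \<and>
    (\<forall>z. expands_le f (real n) z \<longrightarrow> r' < norm_L2 (\<lambda>t. y t - z t)))"
  have "\<exists>p. \<forall>n. P n (p n) \<and> Q n (p n) (p (Suc n))"
  proof (rule dependent_nat_choice)
    show "\<exists>p. P 0 p"
      using lincomb_in_closed_span[OF f, of "{}"] by (intro exI[of _ "(\<lambda>x. 0, 1)"]) (simp add: P_def)
  next
    fix p n assume "P n p"
    moreover obtain x r where p: "p = (x, r)" by (cases p)
    ultimately have "x \<in> ?H" "r > 0" by (auto simp: P_def)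
    from neg[OF this, of n] obtain y e where y: "y \<in> ?H" "norm_L2 (\<lambda>t. y t - x t) < r" "e > 0"
      "\<And>z. expands_le f (real n) z \<Longrightarrow> e \<le> norm_L2 (\<lambda>t. y t - z t)" by blast
    \<comment> \<open>Three demands: below e, to stay off the level set; within the remaining room
      in the ball of radius r; and geometric decay, to make the centres Cauchy.\<close>
    define r' where "r' = min (min (e / 2) (r - norm_L2 (\<lambda>t. y t - x t))) ((1/2) ^ Suc n)"
    have "0 < r'" "r' < e" "norm_L2 (\<lambda>t. y t - x t) + r' \<le> r"
      using y by (auto simp: r'_def)
    moreover have "r' \<le> (1/2) ^ Suc n" unfolding r'_def by (rule min.cobounded2)
    ultimately have "P (Suc n) (y, r') \<and> Q n p (y, r')"
      using y by (fastforce simp: P_def Q_def p simp del: power_Suc)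
    then show "\<exists>q. P (Suc n) q \<and> Q n p q" ..
  qed
  then obtain p where p: "\<And>n. P n (p n)" "\<And>n. Q n (p n) (p (Suc n))" by blast
  define X where "X = (\<lambda>n. fst (p n))"
  define R where "R = (\<lambda>n. snd (p n))"
  have X: "X n \<in> ?H" "0 < R n" "R n \<le> (1/2) ^ n" for n
    using p(1)[of n] by (auto simp: P_def X_def R_def split_beta)
  have XR: "norm_L2 (\<lambda>t. X (Suc n) t - X n t) + R (Suc n) \<le> R n"
    "expands_le f (real n) z \<Longrightarrow> R (Suc n) < norm_L2 (\<lambda>t. X (Suc n) t - z t)" for n z
    using p(2)[of n] by (auto simp: Q_def X_def R_def split_beta)
  have XL: "X n \<in> L2" for n by (rule closed_span_L2_L2[OF X(1)])
  have "norm_L2 (\<lambda>t. X (Suc n) t - X n t) \<le> (1/2) ^ n" for n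
    using XR(1)[of n] X(2)[of "Suc n"] X(3)[of n] by linarith
  from L2_complete[of X, OF XL this] obtain x where x: "x \<in> L2"
    "\<And>n. norm_L2 (\<lambda>t. X n t - x t) \<le> 2 * (1/2) ^ n" by blast
  have small: "\<exists>n. 2 * (1/2) ^ n < e" if pos: "e > 0" for e :: real
  proof -
    obtain n where "(1/2) ^ n < e / 2" using real_arch_pow_inv[of "e/2" "1/2"] pos by auto
    then show ?thesis by (intro exI[of _ n]) simp
  qed
  have xH: "x \<in> ?H"
  proof (rule closed_span_L2_limit[OF f x(1)])
    fix e :: real assume "e > 0"
    then obtain n where "2 * (1/2) ^ n < e" using small by blast
    then show "\<exists>k\<in>?H. norm_L2 (\<lambda>t. x t - k t) < e"
      using x(2)[of n] X(1)[of n] norm_L2_minus_commute[of x "X n"] by force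
  qed
  have dist: "norm_L2 (\<lambda>t. X n t - X (n + k) t) \<le> R n - R (n + k)" for n k
  proof (induction k)
    case (Suc k)
    have "norm_L2 (\<lambda>t. X n t - X (n + Suc k) t)
        \<le> norm_L2 (\<lambda>t. X n t - X (n + k) t) + norm_L2 (\<lambda>t. X (n + k) t - X (n + Suc k) t)"
      by (intro norm_L2_triangle3 XL)
    then show ?case
      using Suc XR(1)[of "n + k"] norm_L2_minus_commute[of "X (n + k)"] by simp
  qed simp
  have near: "norm_L2 (\<lambda>t. X n t - x t) \<le> R n" for n
  proof (rule field_le_epsilon)
    fix e :: real assume "e > 0"
    then obtain k where k: "2 * (1/2) ^ k < e" using small by blast
    have "(1/2::real) ^ (n + k) \<le> (1/2) ^ k" by (rule power_decreasing) auto
    moreover have "norm_L2 (\<lambda>t. X n t - x t)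
        \<le> norm_L2 (\<lambda>t. X n t - X (n + k) t) + norm_L2 (\<lambda>t. X (n + k) t - x t)"
      by (intro norm_L2_triangle3 XL x)
    ultimately show "norm_L2 (\<lambda>t. X n t - x t) \<le> R n + e"
      using dist[of n k] x(2)[of "n + k"] X(2)[of "n + k"] k by linarith
  qed
  \<comment> \<open>The limit has an expansion and so lies in some level set n, although every
    element of that set is farther than \<open>R (Suc n)\<close> from
    \<open>X (Suc n)\<close>.\<close>
  obtain s where "expands_le f s x"
    using ex[OF xH] has_sum_L2_imp_expands_le[where f = f, OF f] by blast
  moreover obtain n :: nat where "s \<le> real n" using real_arch_simple by blast
  ultimately have "expands_le f (real n) x"
    unfolding expands_le_def by (meson order_trans)
  from XR(2)[OF this] near[of "Suc n"] show False by simp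
qed

text \<open>Writing u = (x + u) - x moves the ball to the origin at the price of doubling the level;
  homogeneity then gives K = 2 n / r. The strict inequality for t admits u = 0 and keeps the
  rescaled vector in the open ball.\<close>

lemma expands_le_dense:
  assumes f: "\<And>m. f m \<in> L2" and ex: "\<And>h. h \<in> closed_span_L2 f \<Longrightarrow> \<exists>c. has_sum_L2 (\<lambda>m x. c m * f m x) h"
  shows "\<exists>K\<ge>0. \<forall>u\<in>closed_span_L2 f. \<forall>t>norm_L2 u. \<forall>e>0.
     \<exists>z. expands_le f (K * t) z \<and> norm_L2 (\<lambda>x. u x - z x) < e"
proof -
  obtain n :: nat and x r where x: "x \<in> closed_span_L2 f" "r > 0"
    "\<And>y e. y \<in> closed_span_L2 f \<Longrightarrow> norm_L2 (\<lambda>t. y t - x t) < r \<Longrightarrow> e > 0 \<Longrightarrow>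
       \<exists>z. expands_le f (real n) z \<and> norm_L2 (\<lambda>t. y t - z t) < e"
    using expands_le_dense_in_ball[OF f ex] by metis
  have xL: "x \<in> L2" by (rule closed_span_L2_L2[OF x(1)])
  have unit: "\<exists>z. expands_le f (2 * real n) z \<and> norm_L2 (\<lambda>x. u x - z x) < e"
    if u: "u \<in> closed_span_L2 f" "norm_L2 u < r" "e > 0" for u e
  proof -
    have uL: "u \<in> L2" by (rule closed_span_L2_L2[OF u(1)])
    obtain z where z: "expands_le f (real n) z" "norm_L2 (\<lambda>t. (x t + u t) - z t) < e / 2"
      using x(3)[OF closed_span_L2_add[OF f x(1) u(1)], of "e/2"] u by auto
    obtain w where w: "expands_le f (real n) w" "norm_L2 (\<lambda>t. x t - w t) < e / 2"
      using x(3)[OF x(1), of "e/2"] u x(2) by auto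
    have "norm_L2 (\<lambda>t. ((x t + u t) - z t) - (x t - w t))
        \<le> norm_L2 (\<lambda>t. (x t + u t) - z t) + norm_L2 (\<lambda>t. x t - w t)"
      using z w by (intro norm_L2_triangle_diff L2_diff L2_add xL uL) (auto intro: expands_le_L2)
    then have "norm_L2 (\<lambda>t. u t - (z t - w t)) < e"
      using z w by (simp add: algebra_simps)
    then show ?thesis
      using expands_le_diff[OF f z(1) w(1)] by auto
  qed
  show ?thesis
  proof (intro exI[of _ "2 * real n / r"] conjI ballI allI impI)
    fix u t and e :: real
    assume u: "u \<in> closed_span_L2 f" and t: "norm_L2 u < t" and "e > 0"
    have "t > 0" using t norm_L2_nonneg[of u] by linarith
    have "norm_L2 (\<lambda>x. of_real (r / t) * u x) < r"
      using \<open>r > 0\<close> \<open>t > 0\<close> t unfolding norm_L2_cmult by (simp add: norm_divide field_simps)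
    then obtain z where z: "expands_le f (2 * real n) z" "norm_L2 (\<lambda>x. of_real (r / t) * u x - z x) < e * r / t"
      using unit[OF closed_span_L2_cmult[OF u], of "of_real (r / t)" "e * r / t"] \<open>e > 0\<close> \<open>r > 0\<close> \<open>t > 0\<close> by auto
    have "norm_L2 (\<lambda>x. of_real (t / r) * (of_real (r / t) * u x - z x))
        = t / r * norm_L2 (\<lambda>x. of_real (r / t) * u x - z x)"
      unfolding norm_L2_cmult norm_of_real using \<open>r > 0\<close> \<open>t > 0\<close> by simp
    also have "\<dots> < t / r * (e * r / t)"
      using z(2) \<open>r > 0\<close> \<open>t > 0\<close> by (intro mult_strict_left_mono) auto
    also have "\<dots> = e" using \<open>r > 0\<close> \<open>t > 0\<close> by simp
    finally have "norm_L2 (\<lambda>x. of_real (t / r) * (of_real (r / t) * u x - z x)) < e" .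
    then have "norm_L2 (\<lambda>x. u x - of_real (t / r) * z x) < e"
      using \<open>r > 0\<close> \<open>t > 0\<close> by (simp add: right_diff_distrib)
    moreover have "expands_le f (2 * real n / r * t) (\<lambda>x. of_real (t / r) * z x)"
      using expands_le_cmult[OF z(1), of "of_real (t / r)"] \<open>r > 0\<close> \<open>t > 0\<close>
      by (simp add: norm_divide mult.commute)
    ultimately show "\<exists>z. expands_le f (2 * real n / r * t) z \<and> norm_L2 (\<lambda>x. u x - z x) < e"
      by blast
  qed (use \<open>r > 0\<close> in simp)
qed

text \<open>On a fixed finite index set coefficientwise convergence implies convergence in
  norm.\<close>

lemma norm_L2_lincomb_limit_le:
  assumes f: "\<And>m. f m \<in> L2" and c: "\<And>m. (\<lambda>j. c j m) \<longlonglongrightarrow> d m"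
    and le: "\<forall>\<^sub>F j in sequentially. norm_L2 (lincomb f (c j) F) \<le> s"
  shows "norm_L2 (lincomb f d F) \<le> s"
proof -
  have "(\<lambda>j. s + (\<Sum>m\<in>F. cmod (d m - c j m) * norm_L2 (f m)))
      \<longlonglongrightarrow> s + (\<Sum>m\<in>F. cmod (d m - d m) * norm_L2 (f m))"
    by (intro tendsto_intros c)
  moreover have "\<forall>\<^sub>F j in sequentially. norm_L2 (lincomb f d F)
      \<le> s + (\<Sum>m\<in>F. cmod (d m - c j m) * norm_L2 (f m))"
    using le
  proof eventually_elim
    case (elim j)
    have "norm_L2 (lincomb f d F) \<le> norm_L2 (lincomb f (c j) F) + norm_L2 (lincomb f (\<lambda>m. d m - c j m) F)"
      using norm_L2_le_diff[of "lincomb f d F" "lincomb f (c j) F", OF L2_lincomb L2_lincomb, OF f f]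
      unfolding lincomb_diff .
    then show ?case
      using elim norm_L2_lincomb_le[where f = f, OF f, where F = F and c = "\<lambda>m. d m - c j m"] by linarith
  qed
  ultimately show ?thesis
    using tendsto_lowerbound by fastforce
qed

text \<open>Summing approximate expansions, with errors decaying geometrically, gives exact ones,
  as in the proof of the open mapping theorem.\<close>

lemma expands_le_of_norm:
  assumes f: "\<And>m. f m \<in> L2" and \<alpha>: "\<alpha> > 0" "\<And>m. \<alpha> \<le> norm_L2 (f m)"
    and ex: "\<And>h. h \<in> closed_span_L2 f \<Longrightarrow> \<exists>c. has_sum_L2 (\<lambda>m x. c m * f m x) h"
  shows "\<exists>K\<ge>0. \<forall>u\<in>closed_span_L2 f. \<forall>t>norm_L2 u. expands_le f (K * t) u"
proof -
  obtain K where K: "K \<ge> 0" "\<And>u t e. u \<in> closed_span_L2 f \<Longrightarrow> norm_L2 u < t \<Longrightarrow> e > 0 \<Longrightarrow>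
     \<exists>z. expands_le f (K * t) z \<and> norm_L2 (\<lambda>x. u x - z x) < e"
    using expands_le_dense[OF f ex] by blast
  have "expands_le f (2 * K * t) u" if u: "u \<in> closed_span_L2 f" and t: "norm_L2 u < t" for u t
  proof -
    have "t > 0" using t norm_L2_nonneg[of u] by linarith
    \<comment> \<open>The sequence to be built consists of the remainders left after k corrections;
      the clause for k = 0 fixes the start at u.\<close>
    define P where "P = (\<lambda>k v. v \<in> closed_span_L2 f \<and> norm_L2 v < t * (1/2) ^ k \<and> (k = (0::nat) \<longrightarrow> v = u))"
    define Q where "Q = (\<lambda>k v w. expands_le f (K * (t * (1/2) ^ k)) (\<lambda>x. v x - w x))"
    have "\<exists>U. \<forall>k. P k (U k) \<and> Q k (U k) (U (Suc k))"
    proof (rule dependent_nat_choice)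
      show "\<exists>v. P 0 v" using u t by (auto simp: P_def)
    next
      fix v k assume "P k v"
      then have v: "v \<in> closed_span_L2 f" "norm_L2 v < t * (1/2) ^ k" by (auto simp: P_def)
      obtain z where z: "expands_le f (K * (t * (1/2) ^ k)) z" "norm_L2 (\<lambda>x. v x - z x) < t * (1/2) ^ Suc k"
        using K(2)[OF v, of "t * (1/2) ^ Suc k"] \<open>t > 0\<close> by auto
      have "P (Suc k) (\<lambda>x. v x - z x) \<and> Q k v (\<lambda>x. v x - z x)"
        using z closed_span_L2_diff[OF f v(1) expands_le_closed_span[OF z(1)]] by (simp add: P_def Q_def)
      then show "\<exists>w. P (Suc k) w \<and> Q k v w" by blast
    qed
    then obtain U where U: "\<And>k. P k (U k)" "\<And>k. Q k (U k) (U (Suc k))" by blast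
    have U0: "U 0 = u" and UH: "U k \<in> closed_span_L2 f" and UN: "norm_L2 (U k) < t * (1/2) ^ k" for k
      using U(1)[of 0] U(1)[of k] by (auto simp: P_def)
    have UL: "U k \<in> L2" for k by (rule closed_span_L2_L2[OF UH])
    have "\<exists>c. \<forall>k. has_sum_L2 (\<lambda>m x. c k m * f m x) (\<lambda>x. U k x - U (Suc k) x) \<and>
        (\<forall>F. finite F \<longrightarrow> norm_L2 (lincomb f (c k) F) \<le> K * (t * (1/2) ^ k))"
      by (intro choice allI U(2)[unfolded Q_def expands_le_def])
    then obtain c where c': "\<forall>k. has_sum_L2 (\<lambda>m x. c k m * f m x) (\<lambda>x. U k x - U (Suc k) x) \<and>
        (\<forall>F. finite F \<longrightarrow> norm_L2 (lincomb f (c k) F) \<le> K * (t * (1/2) ^ k))"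
      by (rule exE)
    have c: "has_sum_L2 (\<lambda>m x. c k m * f m x) (\<lambda>x. U k x - U (Suc k) x)"
      "finite F \<Longrightarrow> norm_L2 (lincomb f (c k) F) \<le> K * (t * (1/2) ^ k)" for k F
      using c' by simp_all
    define C where "C = (\<lambda>n m. \<Sum>k<n. c k m)"
    define d where "d = (\<lambda>m. \<Sum>k. c k m)"
    \<comment> \<open>The lower bound \<alpha> on the basis norms enters here: one-term partial sums
      control single coefficients, so the coefficient series converge absolutely.\<close>
    have "norm (c k m) \<le> K * t / \<alpha> * (1/2) ^ k" for k m
    proof -
      have "cmod (c k m) * \<alpha> \<le> cmod (c k m) * norm_L2 (f m)"
        by (intro mult_left_mono \<alpha>) auto
      also have "\<dots> \<le> K * (t * (1/2) ^ k)"
        using c(2)[of "{m}" k] by (simp add: norm_L2_cmult)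
      finally show ?thesis using \<open>\<alpha> > 0\<close> by (simp add: field_simps)
    qed
    moreover have "summable (\<lambda>k. K * t / \<alpha> * (1/2) ^ k)"
      by (intro summable_mult summable_geometric) simp
    ultimately have "summable (\<lambda>k. c k m)" for m
      by (blast intro: summable_comparison_test')
    then have Cd: "(\<lambda>n. C n m) \<longlonglongrightarrow> d m" for m
      unfolding C_def d_def by (rule summable_LIMSEQ)
    have step: "norm_L2 (lincomb f (\<lambda>m. C (n + j) m - C n m) F)
        \<le> 2 * K * t * ((1/2) ^ n - (1/2) ^ (n + j))" if F: "finite F" for n j F
    proof (induction j)
      case (Suc j)
      have eq: "lincomb f (\<lambda>m. C (n + Suc j) m - C n m) F x
          = lincomb f (\<lambda>m. C (n + j) m - C n m) F x + lincomb f (c (n + j)) F x" for x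
        by (simp add: C_def algebra_simps sum.distrib sum_subtractf)
      have "norm_L2 (lincomb f (\<lambda>m. C (n + Suc j) m - C n m) F)
          \<le> norm_L2 (lincomb f (\<lambda>m. C (n + j) m - C n m) F) + norm_L2 (lincomb f (c (n + j)) F)"
        unfolding eq by (intro norm_L2_triangle L2_lincomb f)
      also have "\<dots> \<le> 2 * K * t * ((1/2) ^ n - (1/2) ^ (n + j)) + K * (t * (1/2) ^ (n + j))"
        by (intro add_mono Suc c F)
      also have "\<dots> = 2 * K * t * ((1/2) ^ n - (1/2) ^ (n + Suc j))"
        by (simp add: algebra_simps)
      finally show ?case .
    qed simp
    \<comment> \<open>Uniformity in F is what allows the limit over corrections to be exchanged with
      the limit over finite index sets.\<close>
    have tail: "norm_L2 (lincomb f (\<lambda>m. d m - C n m) F) \<le> 2 * K * t * (1/2) ^ n" if F: "finite F" for n F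
    proof (rule norm_L2_lincomb_limit_le[OF f, where c = "\<lambda>j m. C (n + j) m - C n m"])
      show "(\<lambda>j. C (n + j) m - C n m) \<longlonglongrightarrow> d m - C n m" for m
        using LIMSEQ_ignore_initial_segment[OF Cd, of n m] by (intro tendsto_intros) (simp add: add.commute)
      have "2 * K * t * ((1/2) ^ n - (1/2) ^ (n + j)) \<le> 2 * K * t * (1/2) ^ n" for j
        using K(1) \<open>t > 0\<close> by (intro mult_left_mono) auto
      then show "\<forall>\<^sub>F j in sequentially.
          norm_L2 (lincomb f (\<lambda>m. C (n + j) m - C n m) F) \<le> 2 * K * t * (1/2) ^ n"
        using step[OF F] by (intro always_eventually allI) (meson order_trans)
    qed
    have hs: "has_sum_L2 (\<lambda>m x. C n m * f m x) (\<lambda>x. u x - U n x)" for n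
    proof (induction n)
      case 0
      then show ?case using L2_zero by (simp add: C_def has_sum_L2_def U0)
    next
      case (Suc n)
      have "has_sum_L2 (\<lambda>m x. C n m * f m x + c n m * f m x)
          (\<lambda>x. (u x - U n x) + (U n x - U (Suc n) x))"
        by (intro has_sum_L2_add L2_cmult f Suc c)
      then show ?case by (simp add: C_def distrib_right)
    qed
    have "has_sum_L2 (\<lambda>m x. d m * f m x) u"
      unfolding has_sum_L2_iff
    proof (intro conjI allI impI closed_span_L2_L2[OF u])
      fix e :: real assume "e > 0"
      define r where "r = 2 * K * t + t"
      have "r > 0" using K(1) \<open>t > 0\<close> by (simp add: r_def add_nonneg_pos)
      then obtain n where "(1/2) ^ n < e / (2 * r)"
        using real_arch_pow_inv[of "e / (2 * r)" "1/2"] \<open>e > 0\<close> by auto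
      then have n: "r * (1/2) ^ n < e / 2"
        using \<open>r > 0\<close> by (simp add: field_simps)
      obtain F0 where F0: "finite F0"
        "\<And>F. finite F \<Longrightarrow> F0 \<subseteq> F \<Longrightarrow> norm_L2 (\<lambda>x. lincomb f (C n) F x - (u x - U n x)) < e / 2"
        by (rule has_sum_L2E[OF hs[of n] half_gt_zero[OF \<open>e > 0\<close>]]) (rule that)
      show "\<exists>F0. finite F0 \<and> (\<forall>F. finite F \<and> F0 \<subseteq> F \<longrightarrow> norm_L2 (\<lambda>x. lincomb f d F x - u x) < e)"
      proof (intro exI[of _ F0] conjI F0(1) allI impI)
        fix F assume F: "finite F \<and> F0 \<subseteq> F"
        have "norm_L2 (\<lambda>x. lincomb f d F x - u x)
            \<le> norm_L2 (\<lambda>x. lincomb f d F x - lincomb f (C n) F x) + norm_L2 (\<lambda>x. lincomb f (C n) F x - u x)"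
          by (intro norm_L2_triangle3 L2_lincomb f closed_span_L2_L2[OF u])
        moreover have "norm_L2 (\<lambda>x. (lincomb f (C n) F x - (u x - U n x)) - U n x)
            \<le> norm_L2 (\<lambda>x. lincomb f (C n) F x - (u x - U n x)) + norm_L2 (U n)"
          by (intro norm_L2_triangle_diff L2_diff L2_lincomb f UL closed_span_L2_L2[OF u])
        moreover have "norm_L2 (\<lambda>x. lincomb f d F x - lincomb f (C n) F x) \<le> 2 * K * t * (1/2) ^ n"
          unfolding lincomb_diff using F by (intro tail) auto
        moreover have "2 * K * t * (1/2) ^ n + t * (1/2) ^ n = r * (1/2) ^ n"
          by (simp add: r_def distrib_right)
        ultimately show "norm_L2 (\<lambda>x. lincomb f d F x - u x) < e"
          using n UN[of n] F0(2)[of F] F by (simp add: algebra_simps)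
      qed
    qed
    moreover have "norm_L2 (lincomb f d F) \<le> 2 * K * t" if "finite F" for F
      using tail[OF that, of 0] by (simp add: C_def)
    ultimately show ?thesis unfolding expands_le_def by blast
  qed
  then show ?thesis using K(1) by (intro exI[of _ "2 * K"]) auto
qed

text \<open>By uniqueness, the expansion with controlled partial sums of a finite combination is
  that combination extended by zero, so its partial sums are the coordinate projections. Letting t
  decrease to the norm gives the bound.\<close>

lemma riesz_basic_sequence_projections_bounded:
  assumes "riesz_basic_sequence f"
  shows "\<exists>K\<ge>0. \<forall>F G c. finite G \<and> F \<subseteq> G \<longrightarrow> norm_L2 (lincomb f c F) \<le> K * norm_L2 (lincomb f c G)"
proof -
  have f: "\<And>m. f m \<in> L2" and uniq: "\<And>h. h \<in> closed_span_L2 f \<Longrightarrow> \<exists>!c. has_sum_L2 (\<lambda>m x. c m * f m x) h"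
    using assms by (auto simp: riesz_basic_sequence_def riesz_basis_def unconditional_basis_def)
  obtain \<alpha> where \<alpha>: "\<alpha> > 0" "\<And>m. \<alpha> \<le> norm_L2 (f m)"
    using assms by (auto simp: riesz_basic_sequence_def riesz_basis_def)
  have ex: "\<exists>c. has_sum_L2 (\<lambda>m x. c m * f m x) h" if "h \<in> closed_span_L2 f" for h
    using uniq[OF that] by blast
  obtain K where K: "K \<ge> 0"
    "\<And>u t. u \<in> closed_span_L2 f \<Longrightarrow> norm_L2 u < t \<Longrightarrow> expands_le f (K * t) u"
    using expands_le_of_norm[OF f \<alpha> ex] by blast
  have "norm_L2 (lincomb f c F) \<le> K * norm_L2 (lincomb f c G)" if G: "finite G" "F \<subseteq> G" for F G c
  proof -
    let ?u = "lincomb f c G"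
    define e where "e = (\<lambda>m. if m \<in> G then c m else 0)"
    have u: "?u \<in> closed_span_L2 f" by (rule lincomb_in_closed_span[OF f G(1)])
    have "norm_L2 (lincomb f c F) \<le> K * t" if t: "norm_L2 ?u < t" for t
    proof -
      obtain d where d: "has_sum_L2 (\<lambda>m x. d m * f m x) ?u"
        "\<And>F. finite F \<Longrightarrow> norm_L2 (lincomb f d F) \<le> K * t"
        using K(2)[OF u t] by (auto simp: expands_le_def)
      have "has_sum_L2 (\<lambda>m x. e m * f m x) ?u"
        unfolding e_def by (rule has_sum_L2_finite_support[OF f G(1)])
      with d(1) uniq[OF u] have "d = e" by blast
      then have "lincomb f d F x = lincomb f c F x" for x
        using G by (intro sum.cong) (auto simp: e_def)
      then show ?thesis using d(2)[of F] finite_subset[OF G(2,1)] by simp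
    qed
    then have "norm_L2 (lincomb f c F) \<le> K * (norm_L2 ?u + 1 / real (Suc n))" for n
      by simp
    moreover have "(\<lambda>n. K * (norm_L2 ?u + 1 / real (Suc n))) \<longlonglongrightarrow> K * (norm_L2 ?u + 0)"
      using LIMSEQ_inverse_real_of_nat by (intro tendsto_intros) (simp add: inverse_eq_divide)
    ultimately have "norm_L2 (lincomb f c F) \<le> K * (norm_L2 ?u + 0)"
      using LIMSEQ_le_const by blast
    then show ?thesis by simp
  qed
  then show ?thesis using K(1) by blast
qed

text \<open>Signs are chosen one index at a time: the two squared norms in the parallelogram law
  average to the old squared norm plus |c_m|^2 ||f_m||^2, so one sign gives at most the average and
  one at least. This replaces averaging over random signs.\<close>

lemma exists_signs:
  fixes f :: "int \<Rightarrow> real \<Rightarrow> complex" and c :: "int \<Rightarrow> complex"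
  assumes f: "\<And>m. f m \<in> L2" and "finite F"
  shows "\<exists>\<epsilon>::int \<Rightarrow> complex. (\<forall>m. \<epsilon> m = 1 \<or> \<epsilon> m = -1) \<and>
      (norm_L2 (lincomb f (\<lambda>m. \<epsilon> m * c m) F))\<^sup>2 \<le> (\<Sum>m\<in>F. (cmod (c m))\<^sup>2 * (norm_L2 (f m))\<^sup>2)" (is ?le)
    and "\<exists>\<epsilon>::int \<Rightarrow> complex. (\<forall>m. \<epsilon> m = 1 \<or> \<epsilon> m = -1) \<and>
      (\<Sum>m\<in>F. (cmod (c m))\<^sup>2 * (norm_L2 (f m))\<^sup>2) \<le> (norm_L2 (lincomb f (\<lambda>m. \<epsilon> m * c m) F))\<^sup>2" (is ?ge)
proof -
  have step: "lincomb f (\<lambda>n. (if n = m then \<sigma> else \<epsilon> n) * c n) (insert m F) x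
      = lincomb f (\<lambda>n. \<epsilon> n * c n) F x + \<sigma> * (c m * f m x)"
    if "finite F" "m \<notin> F" for m F \<sigma> \<epsilon> x
  proof -
    have "lincomb f (\<lambda>n. (if n = m then \<sigma> else \<epsilon> n) * c n) F x = lincomb f (\<lambda>n. \<epsilon> n * c n) F x"
      using that by (intro sum.cong) auto
    then show ?thesis using that by (simp add: mult.assoc)
  qed
  have para: "(norm_L2 (\<lambda>x. lincomb f d F x + c m * f m x))\<^sup>2 + (norm_L2 (\<lambda>x. lincomb f d F x - c m * f m x))\<^sup>2
      = 2 * ((norm_L2 (lincomb f d F))\<^sup>2 + (cmod (c m))\<^sup>2 * (norm_L2 (f m))\<^sup>2)" for d F m
    using norm_L2_parallelogram[OF L2_lincomb L2_cmult, OF f f]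
    by (simp add: norm_L2_cmult power_mult_distrib)
  show ?le using assms(2)
  proof (induction F rule: finite_induct)
    case (insert m F)
    then obtain \<epsilon> where \<epsilon>: "\<forall>m. \<epsilon> m = 1 \<or> \<epsilon> m = -1"
      "(norm_L2 (lincomb f (\<lambda>m. \<epsilon> m * c m) F))\<^sup>2 \<le> (\<Sum>m\<in>F. (cmod (c m))\<^sup>2 * (norm_L2 (f m))\<^sup>2)" by blast
    obtain \<sigma> :: complex where \<sigma>: "\<sigma> = 1 \<or> \<sigma> = -1"
      "(norm_L2 (\<lambda>x. lincomb f (\<lambda>n. \<epsilon> n * c n) F x + \<sigma> * (c m * f m x)))\<^sup>2
      \<le> (norm_L2 (lincomb f (\<lambda>n. \<epsilon> n * c n) F))\<^sup>2 + (cmod (c m))\<^sup>2 * (norm_L2 (f m))\<^sup>2"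
      using para[of "\<lambda>n. \<epsilon> n * c n" F m] that[of 1] that[of "-1"] by fastforce
    show ?case
      using insert \<epsilon> \<sigma> by (intro exI[of _ "\<lambda>n. if n = m then \<sigma> else \<epsilon> n"]) (simp only: step[OF insert(1,2)], simp)
  qed auto
  show ?ge using assms(2)
  proof (induction F rule: finite_induct)
    case (insert m F)
    then obtain \<epsilon> where \<epsilon>: "\<forall>m. \<epsilon> m = 1 \<or> \<epsilon> m = -1"
      "(\<Sum>m\<in>F. (cmod (c m))\<^sup>2 * (norm_L2 (f m))\<^sup>2) \<le> (norm_L2 (lincomb f (\<lambda>m. \<epsilon> m * c m) F))\<^sup>2" by blast
    obtain \<sigma> :: complex where \<sigma>: "\<sigma> = 1 \<or> \<sigma> = -1"
      "(norm_L2 (lincomb f (\<lambda>n. \<epsilon> n * c n) F))\<^sup>2 + (cmod (c m))\<^sup>2 * (norm_L2 (f m))\<^sup>2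
      \<le> (norm_L2 (\<lambda>x. lincomb f (\<lambda>n. \<epsilon> n * c n) F x + \<sigma> * (c m * f m x)))\<^sup>2"
      using para[of "\<lambda>n. \<epsilon> n * c n" F m] that[of 1] that[of "-1"] by fastforce
    show ?case
      using insert \<epsilon> \<sigma> by (intro exI[of _ "\<lambda>n. if n = m then \<sigma> else \<epsilon> n"]) (simp only: step[OF insert(1,2)], simp)
  qed auto
qed

lemma riesz_basic_sequence_imp_riesz_bounds:
  assumes "riesz_basic_sequence f"
  shows "\<exists>A>0. \<exists>B>0. riesz_bounds f A B"
proof -
  have f: "\<And>m. f m \<in> L2"
    using assms by (auto simp: riesz_basic_sequence_def)
  obtain \<alpha> \<beta> where \<alpha>: "\<alpha> > 0" "\<And>m. \<alpha> \<le> norm_L2 (f m)" and \<beta>: "\<And>m. norm_L2 (f m) \<le> \<beta>"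
    using assms by (auto simp: riesz_basic_sequence_def riesz_basis_def)
  have "\<beta> > 0" using \<alpha>(1) \<alpha>(2)[of 0] \<beta>[of 0] by linarith
  obtain K0 where K0': "K0 \<ge> 0 \<and> (\<forall>F G c. finite G \<and> F \<subseteq> G \<longrightarrow>
      norm_L2 (lincomb f c F) \<le> K0 * norm_L2 (lincomb f c G))"
    using riesz_basic_sequence_projections_bounded[OF assms] by (rule exE)
  have K0: "K0 \<ge> 0" "finite G \<Longrightarrow> F \<subseteq> G \<Longrightarrow>
      norm_L2 (lincomb f c F) \<le> K0 * norm_L2 (lincomb f c G)" for F G c
    using K0' by simp_all
  \<comment> \<open>A sign change is a difference of two projections, which costs 2 K0; the summand
    1 keeps K positive for the later division.\<close>
  define K where "K = 2 * K0 + 1"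
  have "K > 0" using K0(1) by (simp add: K_def)
  have sgn: "norm_L2 (lincomb f (\<lambda>m. \<epsilon> m * c m) G) \<le> K * norm_L2 (lincomb f c G)"
    if \<epsilon>: "\<forall>m. \<epsilon> m = 1 \<or> \<epsilon> m = (-1::complex)" and G: "finite G" for \<epsilon> c G
  proof -
    have "lincomb f (\<lambda>m. \<epsilon> m * c m) G x
        = lincomb f c {m \<in> G. \<epsilon> m = 1} x - lincomb f c (G - {m \<in> G. \<epsilon> m = 1}) x" for x
    proof -
      have "lincomb f (\<lambda>m. \<epsilon> m * c m) G x = lincomb f (\<lambda>m. \<epsilon> m * c m) {m \<in> G. \<epsilon> m = 1} x
          + lincomb f (\<lambda>m. \<epsilon> m * c m) (G - {m \<in> G. \<epsilon> m = 1}) x"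
        using G by (intro sum.subset_diff[THEN trans[OF _ add.commute]]) auto
      moreover have "lincomb f (\<lambda>m. \<epsilon> m * c m) {m \<in> G. \<epsilon> m = 1} x = lincomb f c {m \<in> G. \<epsilon> m = 1} x"
        by (intro sum.cong) auto
      moreover have "lincomb f (\<lambda>m. \<epsilon> m * c m) (G - {m \<in> G. \<epsilon> m = 1}) x
          = - lincomb f c (G - {m \<in> G. \<epsilon> m = 1}) x"
        unfolding sum_negf[symmetric] using \<epsilon> by (intro sum.cong) auto
      ultimately show ?thesis by simp
    qed
    then have "norm_L2 (lincomb f (\<lambda>m. \<epsilon> m * c m) G)
        \<le> norm_L2 (lincomb f c {m \<in> G. \<epsilon> m = 1}) + norm_L2 (lincomb f c (G - {m \<in> G. \<epsilon> m = 1}))"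
      using norm_L2_triangle_diff[OF L2_lincomb L2_lincomb, OF f f] by simp
    also have "\<dots> \<le> K0 * norm_L2 (lincomb f c G) + K0 * norm_L2 (lincomb f c G)"
      using G by (intro add_mono K0(2)) auto
    also have "\<dots> \<le> K * norm_L2 (lincomb f c G)"
      by (simp add: K_def distrib_right)
    finally show ?thesis .
  qed
  have "riesz_bounds f (\<alpha>\<^sup>2 / K\<^sup>2) (K\<^sup>2 * \<beta>\<^sup>2)"
    unfolding riesz_bounds_def
  proof (intro allI impI conjI)
    fix F :: "int set" and c :: "int \<Rightarrow> complex" assume F: "finite F"
    obtain \<epsilon> :: "int \<Rightarrow> complex" where \<epsilon>: "\<forall>m. \<epsilon> m = 1 \<or> \<epsilon> m = -1"
      "(\<Sum>m\<in>F. (cmod (c m))\<^sup>2 * (norm_L2 (f m))\<^sup>2) \<le> (norm_L2 (lincomb f (\<lambda>m. \<epsilon> m * c m) F))\<^sup>2"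
      using exists_signs(2)[where f = f and c = c, OF f F] by blast
    have "\<alpha>\<^sup>2 * (\<Sum>m\<in>F. (cmod (c m))\<^sup>2) \<le> (\<Sum>m\<in>F. (cmod (c m))\<^sup>2 * (norm_L2 (f m))\<^sup>2)"
      unfolding sum_distrib_left using \<alpha>
      by (intro sum_mono) (auto simp: mult.commute intro!: mult_right_mono power_mono)
    also note \<epsilon>(2)
    also have "(norm_L2 (lincomb f (\<lambda>m. \<epsilon> m * c m) F))\<^sup>2 \<le> (K * norm_L2 (lincomb f c F))\<^sup>2"
      by (intro power_mono sgn \<epsilon> F norm_L2_nonneg)
    finally show "\<alpha>\<^sup>2 / K\<^sup>2 * (\<Sum>m\<in>F. (cmod (c m))\<^sup>2) \<le> (norm_L2 (lincomb f c F))\<^sup>2"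
      using \<open>K > 0\<close> by (simp add: field_simps power_mult_distrib)
  next
    fix F :: "int set" and c :: "int \<Rightarrow> complex" assume F: "finite F"
    obtain \<epsilon> :: "int \<Rightarrow> complex" where \<epsilon>: "\<forall>m. \<epsilon> m = 1 \<or> \<epsilon> m = -1"
      "(norm_L2 (lincomb f (\<lambda>m. \<epsilon> m * c m) F))\<^sup>2 \<le> (\<Sum>m\<in>F. (cmod (c m))\<^sup>2 * (norm_L2 (f m))\<^sup>2)"
      using exists_signs(1)[where f = f and c = c, OF f F] by blast
    \<comment> \<open>Signs are involutive, so \<open>sgn\<close> applied to the signed coefficients
      bounds the original sum, the direction needed for the upper inequality.\<close>
    have cancel: "\<epsilon> m * (\<epsilon> m * c m) = c m" for m using \<epsilon>(1) by (metis mult_1_left mult_minus_left minus_minus)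
    have "norm_L2 (lincomb f c F) \<le> K * norm_L2 (lincomb f (\<lambda>m. \<epsilon> m * c m) F)"
      using sgn[OF \<epsilon>(1) F, of "\<lambda>m. \<epsilon> m * c m"] unfolding cancel .
    then have "(norm_L2 (lincomb f c F))\<^sup>2 \<le> (K * norm_L2 (lincomb f (\<lambda>m. \<epsilon> m * c m) F))\<^sup>2"
      by (intro power_mono norm_L2_nonneg)
    also have "\<dots> \<le> K\<^sup>2 * (\<Sum>m\<in>F. (cmod (c m))\<^sup>2 * (norm_L2 (f m))\<^sup>2)"
      unfolding power_mult_distrib by (intro mult_left_mono \<epsilon>) auto
    also have "\<dots> \<le> K\<^sup>2 * (\<beta>\<^sup>2 * (\<Sum>m\<in>F. (cmod (c m))\<^sup>2))"
      unfolding sum_distrib_left[of "\<beta>\<^sup>2"] using \<beta>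
      by (intro mult_left_mono sum_mono) (auto simp: mult.commute intro!: mult_right_mono power_mono)
    finally show "(norm_L2 (lincomb f c F))\<^sup>2 \<le> K\<^sup>2 * \<beta>\<^sup>2 * (\<Sum>m\<in>F. (cmod (c m))\<^sup>2)"
      by (simp add: mult.assoc)
  qed
  then show ?thesis
    using \<alpha>(1) \<open>K > 0\<close> \<open>\<beta> > 0\<close> by (intro exI[of _ "\<alpha>\<^sup>2 / K\<^sup>2"] exI[of _ "K\<^sup>2 * \<beta>\<^sup>2"] conjI) auto
qed

section \<open>Periodization\<close>

lemma measurable_lebesgue_shift [measurable]: "(\<lambda>x::real. x - c) \<in> lebesgue \<rightarrow>\<^sub>M lebesgue"
  using lebesgue_affine_measurable[of "\<lambda>_. 1" "- c"] by simp

lemma nn_integral_lebesgue_shift: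
  fixes F :: "real \<Rightarrow> ennreal"
  assumes [measurable]: "F \<in> borel_measurable lebesgue"
  shows "(\<integral>\<^sup>+x. F (x - c) \<partial>lebesgue) = (\<integral>\<^sup>+x. F x \<partial>lebesgue)"
proof -
  have "lebesgue = density (distr lebesgue lebesgue (\<lambda>x::real. x - c)) (\<lambda>_. 1)"
    using lebesgue_real_affine[of 1 "- c"] by (simp add: one_ennreal_def)
  then have *: "(lebesgue :: real measure) = distr lebesgue lebesgue (\<lambda>x. x - c)"
    by (simp add: density_1)
  have "(\<integral>\<^sup>+x. F x \<partial>lebesgue) = (\<integral>\<^sup>+x. F x \<partial>(distr lebesgue lebesgue (\<lambda>x. x - c)))"
    using * by simp
  also have "\<dots> = (\<integral>\<^sup>+x. F (x - c) \<partial>lebesgue)"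
    by (rule nn_integral_distr[OF measurable_lebesgue_shift]) simp
  finally show ?thesis ..
qed

text \<open>The translates of [0, a) by multiples of a tile the line. Enumerating the integers by
  \<open>int_decode\<close> turns the bilateral sum into a series of nonnegative functions, which
  may be exchanged with the integral.\<close>

lemma nn_integral_periodization:
  fixes F :: "real \<Rightarrow> ennreal"
  assumes a: "a > 0" and F [measurable]: "F \<in> borel_measurable lebesgue"
  shows "(\<integral>\<^sup>+x. F x \<partial>lebesgue)
       = (\<integral>\<^sup>+x. (\<Sum>n. F (x - of_int (int_decode n) * a)) * indicator {0..a} x \<partial>lebesgue)"
proof -
  define I where "I = (\<lambda>n. {x::real. x + of_int (int_decode n) * a \<in> {0..<a}})"
  have I: "x \<in> I n \<longleftrightarrow> int_decode n = - \<lfloor>x / a\<rfloor>" for x n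
  proof -
    have "x \<in> I n \<longleftrightarrow> of_int (- int_decode n) \<le> x / a \<and> x / a < of_int (- int_decode n) + 1"
      using a by (auto simp: I_def field_simps)
    also have "\<dots> \<longleftrightarrow> \<lfloor>x / a\<rfloor> = - int_decode n"
      by (rule floor_eq_iff[symmetric])
    finally show ?thesis by auto
  qed
  have disj: "disjoint_family I"
    unfolding disjoint_family_on_def using I int_decode_eq by (auto, metis)
  have ex: "\<exists>n. x \<in> I n" for x
    unfolding I by (metis int_encode_inverse)
  have Imeas [measurable]: "I n \<in> sets lebesgue" for n
  proof -
    have "I n = {- of_int (int_decode n) * a ..< a - of_int (int_decode n) * a}"
      by (auto simp: I_def)
    then show ?thesis by simp
  qed
  have [measurable]: "{0..<a} \<in> sets lebesgue" by simp
  have shift [measurable]: "(\<lambda>x. F (x - c)) \<in> borel_measurable lebesgue" for c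
    by (rule measurable_compose[OF measurable_lebesgue_shift F])
  have "F x = (\<Sum>n. F x * indicator (I n) x)" for x
    using ex[of x] suminf_cmult_indicator[OF disj, of x _ "\<lambda>_. F x"] by auto
  then have "(\<integral>\<^sup>+x. F x \<partial>lebesgue) = (\<integral>\<^sup>+x. (\<Sum>n. F x * indicator (I n) x) \<partial>lebesgue)"
    by simp
  also have "\<dots> = (\<Sum>n. \<integral>\<^sup>+x. F x * indicator (I n) x \<partial>lebesgue)"
    by (rule nn_integral_suminf) measurable
  also have "\<dots> = (\<Sum>n. \<integral>\<^sup>+x. F (x - of_int (int_decode n) * a) * indicator {0..<a} x \<partial>lebesgue)"
  proof (rule suminf_cong)
    fix n
    have "(\<integral>\<^sup>+x. F x * indicator (I n) x \<partial>lebesgue)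
        = (\<integral>\<^sup>+x. F (x - of_int (int_decode n) * a) * indicator (I n) (x - of_int (int_decode n) * a) \<partial>lebesgue)"
      by (rule nn_integral_lebesgue_shift[symmetric]) measurable
    also have "\<dots> = (\<integral>\<^sup>+x. F (x - of_int (int_decode n) * a) * indicator {0..<a} x \<partial>lebesgue)"
      by (intro nn_integral_cong) (simp add: I_def indicator_def)
    finally show "(\<integral>\<^sup>+x. F x * indicator (I n) x \<partial>lebesgue)
        = (\<integral>\<^sup>+x. F (x - of_int (int_decode n) * a) * indicator {0..<a} x \<partial>lebesgue)" .
  qed
  also have "\<dots> = (\<integral>\<^sup>+x. (\<Sum>n. F (x - of_int (int_decode n) * a) * indicator {0..<a} x) \<partial>lebesgue)"
    by (rule nn_integral_suminf[symmetric]) measurable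
  \<comment> \<open>The endpoint a is a null set; the closed interval matches the integrals over
    \<open>{0..a}\<close> computed for trigonometric polynomials.\<close>
  also have "\<dots> = (\<integral>\<^sup>+x. (\<Sum>n. F (x - of_int (int_decode n) * a)) * indicator {0..a} x \<partial>lebesgue)"
  proof (rule nn_integral_cong_AE)
    have "AE x in lebesgue. x \<noteq> a"
      by (rule AE_I[where N = "{a}"]) auto
    then show "AE x in lebesgue. (\<Sum>n. F (x - of_int (int_decode n) * a) * indicator {0..<a} x)
        = (\<Sum>n. F (x - of_int (int_decode n) * a)) * indicator {0..a} x"
      by eventually_elim (auto simp: indicator_def)
  qed
  finally show ?thesis .
qed

lemma bracket_self_suminf:
  "bracket_self a g t = (\<Sum>n. ennreal ((cmod (g (t - of_int (int_decode n) * a)))\<^sup>2))"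
proof -
  let ?h = "\<lambda>n. ennreal ((cmod (g (t - of_int n * a)))\<^sup>2)"
  have "bracket_self a g t = (\<Sum>\<^sub>\<infinity>n::nat. ?h (int_decode n))"
    unfolding bracket_self_def by (rule infsum_reindex_bij_betw[OF bij_int_decode, symmetric])
  also have "\<dots> = (\<Sum>n. ?h (int_decode n))"
    by (intro sums_unique has_sum_imp_sums has_sum_infsum nonneg_summable_on_complete) simp
  finally show ?thesis .
qed

lemma bracket_self_periodic: "bracket_self a g (t - of_int k * a) = bracket_self a g t"
proof -
  have "bij_betw (\<lambda>n. n + k) UNIV UNIV"
    by (rule bij_betw_byWitness[where f' = "\<lambda>n. n - k"]) auto
  from infsum_reindex_bij_betw[OF this, of "\<lambda>n. ennreal ((cmod (g (t - of_int n * a)))\<^sup>2)"]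
  show ?thesis by (simp add: bracket_self_def algebra_simps)
qed

lemma bracket_self_measurable:
  assumes g: "g \<in> borel_measurable lebesgue"
  shows "bracket_self a g \<in> borel_measurable lebesgue"
proof -
  have [measurable]: "(\<lambda>x. g (x - c)) \<in> borel_measurable lebesgue" for c
    by (rule measurable_compose[OF measurable_lebesgue_shift g])
  show ?thesis unfolding bracket_self_suminf[abs_def] by measurable
qed

lemma nn_integral_periodic_mult:
  fixes P :: "real \<Rightarrow> ennreal"
  assumes "a > 0" and g [measurable]: "g \<in> borel_measurable lebesgue"
    and P [measurable]: "P \<in> borel_measurable lebesgue" and per: "\<And>x k. P (x - of_int k * a) = P x"
  shows "(\<integral>\<^sup>+x. P x * ennreal ((cmod (g x))\<^sup>2) \<partial>lebesgue)
       = (\<integral>\<^sup>+x. P x * bracket_self a g x * indicator {0..a} x \<partial>lebesgue)"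
  by (subst nn_integral_periodization[OF \<open>a > 0\<close>], measurable)
     (simp add: per bracket_self_suminf ennreal_suminf_cmult)

text \<open>Periodizing the indicator of the exceptional set turns its measure into an integral over
  one period; there every translate has the same value, which is 0 almost everywhere.\<close>

lemma AE_periodic:
  fixes w :: "real \<Rightarrow> ennreal"
  assumes "a > 0" and w [measurable]: "w \<in> borel_measurable lebesgue" and per: "\<And>x k. w (x - of_int k * a) = w x"
    and S [measurable]: "S \<in> sets borel"
    and AE: "AE x in lebesgue. x \<in> {0..a} \<longrightarrow> w x \<in> S"
  shows "AE x in lebesgue. w x \<in> S"
proof -
  define F :: "real \<Rightarrow> ennreal" where "F = (\<lambda>x. indicator (- S) (w x))"
  have [measurable]: "F \<in> borel_measurable lebesgue" unfolding F_def by measurable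
  have "(\<integral>\<^sup>+x. F x \<partial>lebesgue)
      = (\<integral>\<^sup>+x. (\<Sum>n. F (x - of_int (int_decode n) * a)) * indicator {0..a} x \<partial>lebesgue)"
    by (rule nn_integral_periodization[OF \<open>a > 0\<close>]) measurable
  also have "\<dots> = (\<integral>\<^sup>+(x::real). 0 \<partial>lebesgue)"
    using AE by (intro nn_integral_cong_AE) (auto elim!: eventually_mono simp: F_def per indicator_def)
  finally have "AE x in lebesgue. F x = 0"
    using nn_integral_0_iff_AE[of F lebesgue] by simp
  then show ?thesis by eventually_elim (auto simp: F_def indicator_def split: if_splits)
qed

section \<open>Trigonometric polynomials as multipliers of g\<close>

definition trig_poly :: "real \<Rightarrow> (int \<Rightarrow> complex) \<Rightarrow> int set \<Rightarrow> real \<Rightarrow> complex" where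
  "trig_poly a c F x = (\<Sum>m\<in>F. c m * exp (2 * complex_of_real pi * \<i> * complex_of_real (of_int m / a * x)))"

lemma lincomb_modulation:
  "lincomb (\<lambda>m. modulation (of_int m / a) g) c F x = trig_poly a c F x * g x"
  by (simp add: trig_poly_def modulation_def sum_distrib_right mult.assoc)

lemma cmod_modulation: "cmod (modulation c g x) = cmod (g x)"
proof -
  have "exp (2 * complex_of_real pi * \<i> * complex_of_real (c * x)) = cis (2 * pi * (c * x))"
    by (simp add: cis_conv_exp mult_ac)
  then show ?thesis by (simp add: modulation_def norm_mult)
qed

lemma L2_modulation:
  assumes "g \<in> L2"
  shows "modulation c g \<in> L2"
proof (rule L2I_bound)
  have [measurable]: "g \<in> borel_measurable lebesgue" by (rule L2_measurable[OF assms])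
  have "(\<lambda>x. exp (2 * complex_of_real pi * \<i> * complex_of_real (c * x))) \<in> borel_measurable borel"
    by (intro borel_measurable_continuous_onI continuous_intros)
  then have "(\<lambda>x. exp (2 * complex_of_real pi * \<i> * complex_of_real (c * x))) \<in> borel_measurable lebesgue"
    by (auto intro: measurable_completion)
  then show "modulation c g \<in> borel_measurable lebesgue"
    unfolding modulation_def by measurable
qed (use L2_integrable[OF assms] in \<open>auto simp: cmod_modulation\<close>)

lemma continuous_on_trig_poly: "continuous_on S (trig_poly a c F)"
  unfolding trig_poly_def[abs_def] by (intro continuous_intros)

lemma trig_poly_measurable: "trig_poly a c F \<in> borel_measurable lebesgue"
  using borel_measurable_continuous_onI[OF continuous_on_trig_poly] by (auto intro: measurable_completion)

lemma exp_even_int_pi: "exp (of_int (2 * k) * (complex_of_real pi * \<i>)) = 1"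
  unfolding exp_eq_1 by (intro conjI exI[of _ k]) simp_all

lemma trig_poly_periodic:
  assumes "a \<noteq> 0"
  shows "trig_poly a c F (x - of_int k * a) = trig_poly a c F x"
proof -
  have "exp (2 * complex_of_real pi * \<i> * complex_of_real (of_int m / a * (x - of_int k * a)))
      = exp (2 * complex_of_real pi * \<i> * complex_of_real (of_int m / a * x))" for m
  proof -
    have "2 * complex_of_real pi * \<i> * complex_of_real (of_int m / a * (x - of_int k * a))
        = 2 * complex_of_real pi * \<i> * complex_of_real (of_int m / a * x) + of_int (2 * (- (m * k))) * (of_real pi * \<i>)"
      using assms by (simp add: field_simps)
    then show ?thesis by (simp only: exp_add exp_even_int_pi mult_1_right)
  qed
  then show ?thesis by (simp add: trig_poly_def)
qed

text \<open>The frequencies m / a are those of period a, which lets |p|^2 pass through the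
  periodization. Stating the identity in \<open>ennreal\<close> avoids a prior integrability
  argument for the weighted polynomial.\<close>

lemma norm_L2_lincomb_modulation:
  assumes "a > 0" "g \<in> L2"
  shows "ennreal ((norm_L2 (lincomb (\<lambda>m. modulation (of_int m / a) g) c F))\<^sup>2)
    = (\<integral>\<^sup>+x. ennreal ((cmod (trig_poly a c F x))\<^sup>2) * bracket_self a g x * indicator {0..a} x \<partial>lebesgue)"
proof -
  let ?f = "\<lambda>m. modulation (of_int m / a) g"
  have [measurable]: "g \<in> borel_measurable lebesgue" "trig_poly a c F \<in> borel_measurable lebesgue"
    by (rule L2_measurable[OF assms(2)] trig_poly_measurable)+
  have "ennreal ((norm_L2 (lincomb ?f c F))\<^sup>2) = (\<integral>\<^sup>+x. ennreal ((cmod (lincomb ?f c F x))\<^sup>2) \<partial>lebesgue)"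
    by (intro norm_L2_sq_nn[symmetric] L2_lincomb L2_modulation assms)
  also have "\<dots> = (\<integral>\<^sup>+x. ennreal ((cmod (trig_poly a c F x))\<^sup>2) * ennreal ((cmod (g x))\<^sup>2) \<partial>lebesgue)"
    unfolding lincomb_modulation by (simp add: norm_mult power_mult_distrib ennreal_mult)
  also have "\<dots> = (\<integral>\<^sup>+x. ennreal ((cmod (trig_poly a c F x))\<^sup>2) * bracket_self a g x * indicator {0..a} x \<partial>lebesgue)"
    using assms(1) by (intro nn_integral_periodic_mult) (auto simp: trig_poly_periodic)
  finally show ?thesis .
qed

lemma has_integral_trig_monomial:
  assumes "a > 0"
  shows "((\<lambda>x. exp (2 * complex_of_real pi * \<i> * complex_of_real (of_int k / a * x)))
    has_integral (if k = 0 then of_real a else 0)) {0..a}"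
proof (cases "k = 0")
  case True
  then show ?thesis using has_integral_const_real[of "1::complex" 0 a] assms by (simp add: scaleR_conv_of_real)
next
  case False
  define \<omega> where "\<omega> = 2 * complex_of_real pi * \<i> * of_int k / of_real a"
  have \<omega>: "\<omega> \<noteq> 0" using False assms by (simp add: \<omega>_def)
  have eq: "2 * complex_of_real pi * \<i> * complex_of_real (of_int k / a * x) = \<omega> * of_real x" for x
    by (simp add: \<omega>_def)
  have "((\<lambda>x. exp (\<omega> * of_real x)) has_integral (exp (\<omega> * of_real a) / \<omega> - exp (\<omega> * of_real 0) / \<omega>)) {0..a}"
  proof (rule fundamental_theorem_of_calculus)
    fix x
    have "((\<lambda>z. exp (\<omega> * z) / \<omega>) has_field_derivative exp (\<omega> * of_real x)) (at (of_real x))"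
      using \<omega> by (auto intro!: derivative_eq_intros)
    then show "((\<lambda>x. exp (\<omega> * of_real x) / \<omega>) has_vector_derivative exp (\<omega> * of_real x)) (at x within {0..a})"
      by (rule has_vector_derivative_real_field[THEN has_vector_derivative_at_within])
  qed (use assms in simp)
  moreover have "exp (\<omega> * of_real a) = 1"
  proof -
    have "\<omega> * of_real a = of_int (2 * k) * (of_real pi * \<i>)" using assms by (simp add: \<omega>_def)
    then show ?thesis by (simp only: exp_even_int_pi)
  qed
  ultimately show ?thesis unfolding eq using False by simp
qed

text \<open>Orthogonality on an interval of length a: only the diagonal of the double sum survives,
  and each diagonal term carries the length a. This is the source of the factor relating bracket
  bounds to squared Riesz constants.\<close>

lemma nn_integral_trig_poly:
  assumes "a > 0" "finite F"
  shows "(\<integral>\<^sup>+x. ennreal ((cmod (trig_poly a c F x))\<^sup>2) * indicator {0..a} x \<partial>lebesgue)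
    = ennreal (a * (\<Sum>m\<in>F. (cmod (c m))\<^sup>2))"
proof -
  let ?e = "\<lambda>k x. exp (2 * complex_of_real pi * \<i> * complex_of_real (of_int k / a * x))"
  have ee: "?e m x * cnj (?e k x) = ?e (m - k) x" for m k x
    by (simp add: exp_cnj mult_exp_exp algebra_simps diff_divide_distrib)
  have "of_real ((cmod (trig_poly a c F x))\<^sup>2)
      = (\<Sum>m\<in>F. \<Sum>k\<in>F. (c m * cnj (c k)) * ?e (m - k) x)" for x
  proof -
    have "of_real ((cmod (trig_poly a c F x))\<^sup>2) = trig_poly a c F x * cnj (trig_poly a c F x)"
      by (rule complex_norm_square)
    also have "\<dots> = (\<Sum>m\<in>F. \<Sum>k\<in>F. (c m * ?e m x) * cnj (c k * ?e k x))"
      unfolding trig_poly_def cnj_sum by (rule sum_product)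
    also have "\<dots> = (\<Sum>m\<in>F. \<Sum>k\<in>F. (c m * cnj (c k)) * ?e (m - k) x)"
      unfolding ee[symmetric] by (simp add: mult_ac)
    finally show ?thesis .
  qed
  moreover have "((\<lambda>x. \<Sum>m\<in>F. \<Sum>k\<in>F. (c m * cnj (c k)) * ?e (m - k) x) has_integral
      (\<Sum>m\<in>F. \<Sum>k\<in>F. (c m * cnj (c k)) * (if m - k = 0 then of_real a else 0))) {0..a}"
    by (intro has_integral_sum assms has_integral_mult_right has_integral_trig_monomial)
  moreover have "(\<Sum>m\<in>F. \<Sum>k\<in>F. (c m * cnj (c k)) * (if m - k = 0 then of_real a else 0))
      = of_real (a * (\<Sum>m\<in>F. (cmod (c m))\<^sup>2))"
  proof -
    have "(\<Sum>k\<in>F. (c m * cnj (c k)) * (if m - k = 0 then of_real a else 0)) = of_real (a * (cmod (c m))\<^sup>2)"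
      if "m \<in> F" for m
    proof -
      have "(\<Sum>k\<in>F. (c m * cnj (c k)) * (if m - k = 0 then of_real a else 0))
          = (\<Sum>k\<in>F. if k = m then (c m * cnj (c m)) * of_real a else 0)"
        by (intro sum.cong) auto
      also have "\<dots> = (c m * cnj (c m)) * of_real a"
        using assms(2) that by simp
      finally show ?thesis by (simp add: complex_norm_square[symmetric] mult.commute)
    qed
    then show ?thesis by (simp add: sum_distrib_left)
  qed
  ultimately have "((\<lambda>x. complex_of_real ((cmod (trig_poly a c F x))\<^sup>2)) has_integral
      of_real (a * (\<Sum>m\<in>F. (cmod (c m))\<^sup>2))) {0..a}"
    by simp
  from has_integral_linear[OF this bounded_linear_Re]
  have "((\<lambda>x. (cmod (trig_poly a c F x))\<^sup>2) has_integral (a * (\<Sum>m\<in>F. (cmod (c m))\<^sup>2))) {0..a}"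
    by (simp add: o_def)
  from nn_integral_has_integral_lebesgue[OF _ this]
  have "(\<integral>\<^sup>+x. ennreal (indicator {0..a} x * (cmod (trig_poly a c F x))\<^sup>2) \<partial>lebesgue)
      = ennreal (a * (\<Sum>m\<in>F. (cmod (c m))\<^sup>2))"
    by (simp add: nn_integral_completion)
  moreover have "(\<integral>\<^sup>+x. ennreal ((cmod (trig_poly a c F x))\<^sup>2) * indicator {0..a} x \<partial>lebesgue)
      = (\<integral>\<^sup>+x. ennreal (indicator {0..a} x * (cmod (trig_poly a c F x))\<^sup>2) \<partial>lebesgue)"
    by (intro nn_integral_cong) (auto simp: indicator_def)
  ultimately show ?thesis by simp
qed

lemma bracket_bounds_imp_riesz_bounds:
  assumes "a > 0" "g \<in> L2" "A \<ge> 0" "B \<ge> 0" and bb: "bracket_bounds a g A B"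
  shows "riesz_bounds (\<lambda>m. modulation (of_int m / a) g) (a * A) (a * B)"
  unfolding riesz_bounds_def
proof (intro allI impI)
  let ?f = "\<lambda>m. modulation (of_int m / a) g"
  fix F :: "int set" and c :: "int \<Rightarrow> complex" assume F: "finite F"
  let ?p = "\<lambda>x. ennreal ((cmod (trig_poly a c F x))\<^sup>2)" and ?S = "\<Sum>m\<in>F. (cmod (c m))\<^sup>2"
  have [measurable]: "trig_poly a c F \<in> borel_measurable lebesgue" by (rule trig_poly_measurable)
  have [measurable]: "{0..a} \<in> sets lebesgue" by simp
  have meas: "(\<lambda>x. ?p x * indicator {0..a} x) \<in> borel_measurable lebesgue" by measurable
  have const: "(\<integral>\<^sup>+x. ennreal C * (?p x * indicator {0..a} x) \<partial>lebesgue) = ennreal (a * C * ?S)"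
    if "C \<ge> 0" for C
  proof -
    have "(\<integral>\<^sup>+x. ennreal C * (?p x * indicator {0..a} x) \<partial>lebesgue) = ennreal C * ennreal (a * ?S)"
      unfolding nn_integral_cmult[OF meas] nn_integral_trig_poly[OF assms(1) F] ..
    also have "\<dots> = ennreal (C * (a * ?S))"
      using that by (rule ennreal_mult'[symmetric])
    finally show ?thesis by (simp add: mult_ac)
  qed
  have "ennreal (a * A * ?S) \<le> (\<integral>\<^sup>+x. ?p x * bracket_self a g x * indicator {0..a} x \<partial>lebesgue)"
    unfolding const[OF assms(3), symmetric]
  proof (rule nn_integral_mono_AE)
    show "AE x in lebesgue. ennreal A * (?p x * indicator {0..a} x) \<le> ?p x * bracket_self a g x * indicator {0..a} x"
      using bb unfolding bracket_bounds_def
      by eventually_elim (auto simp: indicator_def mult.commute intro!: mult_right_mono)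
  qed
  moreover have "(\<integral>\<^sup>+x. ?p x * bracket_self a g x * indicator {0..a} x \<partial>lebesgue) \<le> ennreal (a * B * ?S)"
    unfolding const[OF assms(4), symmetric]
  proof (rule nn_integral_mono_AE)
    show "AE x in lebesgue. ?p x * bracket_self a g x * indicator {0..a} x \<le> ennreal B * (?p x * indicator {0..a} x)"
      using bb unfolding bracket_bounds_def
      by eventually_elim (auto simp: indicator_def mult.commute intro!: mult_right_mono)
  qed
  ultimately show "a * A * ?S \<le> (norm_L2 (lincomb ?f c F))\<^sup>2 \<and> (norm_L2 (lincomb ?f c F))\<^sup>2 \<le> a * B * ?S"
    unfolding norm_L2_lincomb_modulation[OF assms(1,2), symmetric]
    using assms by (subst (asm) (1 2) ennreal_le_iff) (auto intro!: mult_nonneg_nonneg sum_nonneg)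
qed

section \<open>From Riesz inequalities to bounds on the bracket\<close>

definition is_trig_poly :: "real \<Rightarrow> (real \<Rightarrow> complex) \<Rightarrow> bool" where
  "is_trig_poly a p \<longleftrightarrow> (\<exists>F c. finite F \<and> p = trig_poly a c F)"

lemma is_trig_poly_monomial:
  "is_trig_poly a (\<lambda>x. b * exp (2 * complex_of_real pi * \<i> * complex_of_real (of_int k / a * x)))"
  unfolding is_trig_poly_def
  by (intro exI[of _ "{k}"] exI[of _ "\<lambda>_. b"]) (simp add: trig_poly_def[abs_def])

lemma is_trig_poly_const: "is_trig_poly a (\<lambda>x. b)"
  using is_trig_poly_monomial[of a b 0] by simp

lemma is_trig_poly_add:
  assumes "is_trig_poly a p" "is_trig_poly a q"
  shows "is_trig_poly a (\<lambda>x. p x + q x)"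
proof -
  obtain F c where F: "finite F" "p = trig_poly a c F" using assms by (auto simp: is_trig_poly_def)
  obtain G d where G: "finite G" "q = trig_poly a d G" using assms by (auto simp: is_trig_poly_def)
  let ?b = "\<lambda>m. (if m \<in> F then c m else 0) + (if m \<in> G then d m else 0)"
  have "trig_poly a (\<lambda>m. if m \<in> F then c m else 0) (F \<union> G) x = trig_poly a c F x"
    "trig_poly a (\<lambda>m. if m \<in> G then d m else 0) (F \<union> G) x = trig_poly a d G x" for x
    unfolding trig_poly_def using F G by (auto intro!: sum.mono_neutral_cong_right)
  then have "p x + q x = trig_poly a ?b (F \<union> G) x" for x
    unfolding F G by (simp add: trig_poly_def distrib_right sum.distrib)
  then show ?thesis
    unfolding is_trig_poly_def using F G by (intro exI[of _ "F \<union> G"] exI[of _ ?b]) auto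
qed

lemma is_trig_poly_sum:
  "(\<And>m. m \<in> F \<Longrightarrow> is_trig_poly a (p m)) \<Longrightarrow> is_trig_poly a (\<lambda>x. \<Sum>m\<in>F. p m x)"
  by (induction F rule: infinite_finite_induct) (auto intro: is_trig_poly_const is_trig_poly_add)

lemma is_trig_poly_mult:
  assumes "is_trig_poly a p" "is_trig_poly a q"
  shows "is_trig_poly a (\<lambda>x. p x * q x)"
proof -
  let ?e = "\<lambda>k x. exp (2 * complex_of_real pi * \<i> * complex_of_real (of_int k / a * x))"
  obtain F c where F: "finite F" "p = trig_poly a c F" using assms by (auto simp: is_trig_poly_def)
  obtain G d where G: "finite G" "q = trig_poly a d G" using assms by (auto simp: is_trig_poly_def)
  have ee: "?e m x * ?e k x = ?e (m + k) x" for m k x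
    by (simp add: mult_exp_exp algebra_simps add_divide_distrib)
  have "p x * q x = (\<Sum>m\<in>F. \<Sum>k\<in>G. (c m * d k) * ?e (m + k) x)" for x
    unfolding F G trig_poly_def sum_product ee[symmetric] by (simp add: mult_ac)
  then have "(\<lambda>x. p x * q x) = (\<lambda>x. \<Sum>m\<in>F. \<Sum>k\<in>G. (c m * d k) * ?e (m + k) x)" by blast
  then show ?thesis by (simp only:) (intro is_trig_poly_sum is_trig_poly_monomial)
qed

text \<open>On the circle a real-linear function is a combination of cosine and sine, hence of the
  frequencies 1 and -1; other polynomials follow since trigonometric polynomials form an
  algebra.\<close>

lemma is_trig_poly_polynomial_on_circle:
  assumes "real_polynomial_function h"
  shows "is_trig_poly a (\<lambda>x. complex_of_real (h (cis (2 * pi * x / a))))"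
  using assms
proof induction
  case (linear h)
  let ?e = "\<lambda>k x. exp (2 * complex_of_real pi * \<i> * complex_of_real (of_int k / a * x))"
  have e: "?e 1 x = cis (2 * pi * x / a)" "?e (-1) x = cnj (cis (2 * pi * x / a))" for x
    by (simp_all add: cis_conv_exp cis_cnj exp_cnj mult_ac)
  have cis: "of_real (cos y) = 1 / 2 * cis y + 1 / 2 * cnj (cis y)"
    "of_real (sin y) = - \<i> / 2 * cis y + \<i> / 2 * cnj (cis y)" for y
    by (simp_all add: complex_eq_iff)
  have "h (cis y) = cos y * h 1 + sin y * h \<i>" for y
  proof -
    have "cis y = cos y *\<^sub>R 1 + sin y *\<^sub>R \<i>" by (simp add: complex_eq_iff)
    then show ?thesis
      by (simp add: bounded_linear.linear[OF linear] linear_add linear_scale)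
  qed
  then have eq: "complex_of_real (h (cis (2 * pi * x / a)))
      = (of_real (h 1) * (1 / 2)) * ?e 1 x + (of_real (h 1) * (1 / 2)) * ?e (-1) x
        + ((of_real (h \<i>) * (- \<i> / 2)) * ?e 1 x + (of_real (h \<i>) * (\<i> / 2)) * ?e (-1) x)" for x
    unfolding e by (simp only: of_real_add of_real_mult cis) (simp add: algebra_simps)
  show ?case
    unfolding eq by (intro is_trig_poly_add is_trig_poly_monomial)
next
  case (const b)
  then show ?case by (rule is_trig_poly_const)
next
  case (add h k)
  then show ?case using is_trig_poly_add by simp
next
  case (mult h k)
  then show ?case using is_trig_poly_mult by simp
qed

text \<open>A continuous function on \<open>[0, a]\<close> with equal end values descends to the unit circle,
  a quotient of the compact interval, where the Stone-Weierstrass theorem applies.\<close>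

lemma trig_poly_approx:
  fixes \<phi> :: "real \<Rightarrow> real"
  assumes a: "a > 0" and \<phi>: "continuous_on {0..a} \<phi>" "\<phi> 0 = \<phi> a" and "e > 0"
  shows "\<exists>p. is_trig_poly a p \<and> (\<forall>x\<in>{0..a}. cmod (of_real (\<phi> x) - p x) < e)"
proof -
  define q where "q = (\<lambda>x. cis (2 * pi * x / a))"
  \<comment> \<open>\<open>Arg2pi\<close> jumps at 1 between 2 pi and 0; the end condition
    \<open>\<phi> 0 = \<phi> a\<close> makes \<open>\<psi>\<close> insensitive to the jump.\<close>
  define \<psi> where "\<psi> = (\<lambda>z. \<phi> (a * Arg2pi z / (2 * pi)))"
  have \<psi>q: "\<psi> (q x) = \<phi> x" if x: "x \<in> {0..a}" for x
  proof (cases "x = a")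
    case True
    then have "q x = 1" using a by (simp add: q_def)
    then show ?thesis using True \<phi>(2) Arg2pi_of_real[of 1] by (simp add: \<psi>_def)
  next
    case False
    have "Arg2pi (exp (\<i> * of_real (2 * pi * x / a))) = Im (\<i> * of_real (2 * pi * x / a))"
      using a x False by (intro Arg2pi_exp) (simp_all add: field_simps)
    then show ?thesis using a by (simp add: \<psi>_def q_def cis_conv_exp)
  qed
  have surj: "\<exists>x\<in>{0..a}. q x = z" if z: "z \<in> sphere 0 1" for z
  proof (intro bexI[of _ "a * Arg2pi z / (2 * pi)"])
    have "exp (\<i> * of_real (Arg2pi z)) = z"
      using z complex_norm_eq_1_exp[of z] by simp
    then show "q (a * Arg2pi z / (2 * pi)) = z" using a by (simp add: q_def cis_conv_exp)
    show "a * Arg2pi z / (2 * pi) \<in> {0..a}"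
      using a Arg2pi[of z] by (simp add: field_simps)
  qed
  have "continuous_on (sphere 0 1) \<psi>"
    unfolding continuous_on_closed_vimage[OF closed_sphere]
  proof (intro allI impI)
    fix B :: "real set" assume B: "closed B"
    \<comment> \<open>Preimages of closed sets are images of compact sets under q, so continuity of
      \<open>\<psi>\<close> follows without discussing \<open>Arg2pi\<close> near its jump.\<close>
    have "\<psi> -` B \<inter> sphere 0 1 = q ` (\<phi> -` B \<inter> {0..a})"
    proof (intro equalityI subsetI)
      fix z assume z: "z \<in> \<psi> -` B \<inter> sphere 0 1"
      then obtain x where x: "x \<in> {0..a}" "q x = z" using surj by blast
      then show "z \<in> q ` (\<phi> -` B \<inter> {0..a})" using z \<psi>q[OF x(1)] by auto
    next
      fix z assume "z \<in> q ` (\<phi> -` B \<inter> {0..a})"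
      then show "z \<in> \<psi> -` B \<inter> sphere 0 1" using \<psi>q by (auto simp: q_def)
    qed
    moreover have "compact (\<phi> -` B \<inter> {0..a})"
      using \<phi>(1) B bounded_subset[of "{0..a}" "\<phi> -` B \<inter> {0..a}"]
      by (auto simp: continuous_on_closed_vimage compact_eq_bounded_closed)
    moreover have "continuous_on S q" for S
      unfolding q_def cis_conv_exp by (intro continuous_intros) (use a in simp)
    ultimately show "closed (\<psi> -` B \<inter> sphere 0 1)"
      by (metis compact_continuous_image compact_imp_closed)
  qed
  then obtain h where h: "real_polynomial_function h" "\<And>z. z \<in> sphere 0 1 \<Longrightarrow> \<bar>\<psi> z - h z\<bar> < e"
    using Stone_Weierstrass_real_polynomial_function[OF compact_sphere _ \<open>e > 0\<close>] by blast
  have "cmod (of_real (\<phi> x) - of_real (h (q x))) < e" if "x \<in> {0..a}" for x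
    using h(2)[of "q x"] \<psi>q[OF that] by (simp add: q_def flip: of_real_diff)
  then show ?thesis
    using is_trig_poly_polynomial_on_circle[OF h(1), of a] unfolding q_def
    by (intro exI[of _ "\<lambda>x. of_real (h (cis (2 * pi * x / a)))"]) auto
qed

text \<open>A measurable function is almost everywhere a limit of continuous ones. Clamping to
  [0, 1] and cutting off near the endpoints makes these bounded with equal end values, and uniform
  approximation with error below 1 keeps the bound 2 required for dominated convergence.\<close>

lemma trig_poly_approx_indicator:
  assumes a: "a > 0" and E: "E \<in> sets lebesgue" "E \<subseteq> {0..a}"
  shows "\<exists>p. (\<forall>n. is_trig_poly a (p n)) \<and> (\<forall>n. \<forall>x\<in>{0..a}. cmod (p n x) \<le> 2) \<and>
    (AE x in lebesgue. x \<in> {0..a} \<longrightarrow> (\<lambda>n. p n x) \<longlonglongrightarrow> indicator E x)"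
proof -
  have "(indicator E :: real \<Rightarrow> real) measurable_on UNIV"
    using E(1) by (intro lebesgue_measurable_imp_measurable_on) auto
  then obtain N h where N: "negligible N" and h: "\<And>n. continuous_on UNIV (h n)"
    "\<And>x. x \<notin> N \<Longrightarrow> (\<lambda>n. h n x) \<longlonglongrightarrow> (indicator E x :: real)"
    unfolding measurable_on_def by auto
  \<comment> \<open>A cut-off vanishing at 0 and a, so that the end values match, and eventually
    equal to 1 at every interior point.\<close>
  define \<kappa> where "\<kappa> = (\<lambda>n x. min 1 (real n * max 0 (min x (a - x))))"
  define \<phi> where "\<phi> = (\<lambda>n x. max 0 (min 1 (h n x)) * \<kappa> n x)"
  have \<phi>: "0 \<le> \<phi> n x" "\<phi> n x \<le> 1" for n x
    by (auto simp: \<phi>_def \<kappa>_def intro!: mult_le_one)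
  have "continuous_on {0..a} (\<phi> n)" for n
    unfolding \<phi>_def \<kappa>_def
    by (intro continuous_intros continuous_on_subset[OF h(1)]) auto
  moreover have "\<phi> n 0 = \<phi> n a" for n
    using a by (simp add: \<phi>_def \<kappa>_def)
  ultimately have "\<exists>p. is_trig_poly a p \<and> (\<forall>x\<in>{0..a}. cmod (of_real (\<phi> n x) - p x) < 1 / real (Suc n))" for n
    using a by (intro trig_poly_approx) auto
  then obtain p where p: "\<And>n. is_trig_poly a (p n)"
    "\<And>n x. x \<in> {0..a} \<Longrightarrow> cmod (of_real (\<phi> n x) - p n x) < 1 / real (Suc n)"
    by metis
  have "cmod (p n x) \<le> 2" if "x \<in> {0..a}" for n x
  proof -
    have "cmod (p n x) \<le> cmod (of_real (\<phi> n x)) + cmod (of_real (\<phi> n x) - p n x)"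
      by (metis norm_triangle_sub norm_minus_commute)
    moreover have "1 / real (Suc n) \<le> 1" by simp
    moreover have "cmod (of_real (\<phi> n x)) \<le> 1" using \<phi>[of n x] by simp
    ultimately show ?thesis using p(2)[OF that, of n] by linarith
  qed
  moreover have "AE x in lebesgue. x \<in> {0..a} \<longrightarrow> (\<lambda>n. p n x) \<longlonglongrightarrow> indicator E x"
  proof (rule AE_I'[of "N \<union> {0, a}"])
    show "N \<union> {0, a} \<in> null_sets lebesgue"
      using N by (simp add: negligible_iff_null_sets[symmetric])
    have "(\<lambda>n. p n x) \<longlonglongrightarrow> indicator E x" if x: "x \<in> {0..a}" "x \<notin> N \<union> {0, a}" for x
    proof -
      define d where "d = min x (a - x)"
      have "d > 0" using x by (auto simp: d_def)
      then obtain M :: nat where M: "1 / d < real M" using reals_Archimedean2 by blast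
      have "\<kappa> n x = 1" if "n \<ge> M" for n
      proof -
        have "1 / d < real n" using M that by linarith
        then have "1 < real n * d" using \<open>d > 0\<close> by (simp add: field_simps)
        then show ?thesis using \<open>d > 0\<close> by (simp add: \<kappa>_def d_def[symmetric])
      qed
      then have "(\<lambda>n. \<kappa> n x) \<longlonglongrightarrow> 1"
        by (intro tendsto_eventually) (auto simp: eventually_sequentially)
      moreover have "(\<lambda>n. max 0 (min 1 (h n x))) \<longlonglongrightarrow> max 0 (min 1 (indicator E x))"
        using x by (intro tendsto_intros h(2)) auto
      ultimately have "(\<lambda>n. \<phi> n x) \<longlonglongrightarrow> max 0 (min 1 (indicator E x)) * 1"
        unfolding \<phi>_def by (intro tendsto_mult)
      then have "(\<lambda>n. complex_of_real (\<phi> n x)) \<longlonglongrightarrow> of_real (indicator E x)"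
        by (intro tendsto_of_real) (simp add: indicator_def split: if_splits)
      moreover have "(\<lambda>n. of_real (\<phi> n x) - p n x) \<longlonglongrightarrow> 0"
      proof (rule Lim_null_comparison)
        show "\<forall>\<^sub>F n in sequentially. cmod (of_real (\<phi> n x) - p n x) \<le> 1 / real (Suc n)"
          using p(2)[OF x(1)] by (intro always_eventually allI less_imp_le)
        show "(\<lambda>n. 1 / real (Suc n)) \<longlonglongrightarrow> 0"
          using LIMSEQ_inverse_real_of_nat by (simp add: inverse_eq_divide)
      qed
      ultimately have "(\<lambda>n. of_real (\<phi> n x) - (of_real (\<phi> n x) - p n x)) \<longlonglongrightarrow> of_real (indicator E x) - 0"
        by (rule tendsto_diff)
      then show ?thesis by (cases "x \<in> E") simp_all
    qed
    then show "{x \<in> space lebesgue. \<not> (x \<in> {0..a} \<longrightarrow> (\<lambda>n. p n x) \<longlonglongrightarrow> indicator E x)} \<subseteq> N \<union> {0, a}"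
      by blast
  qed
  ultimately show ?thesis using p(1) by blast
qed

text \<open>Dominated convergence with majorant 4 w, where 4 is the square of the bound on p. It
  serves both for the bracket and for the constant weight 1.\<close>

lemma nn_integral_trig_poly_weight_limit:
  fixes w :: "real \<Rightarrow> ennreal" and p :: "nat \<Rightarrow> real \<Rightarrow> complex"
  assumes w [measurable]: "w \<in> borel_measurable lebesgue"
    and fin: "(\<integral>\<^sup>+x. w x * indicator {0..a} x \<partial>lebesgue) < \<infinity>"
    and p: "\<And>n. is_trig_poly a (p n)" "\<And>n x. x \<in> {0..a} \<Longrightarrow> cmod (p n x) \<le> 2"
    and lim: "AE x in lebesgue. x \<in> {0..a} \<longrightarrow> (\<lambda>n. p n x) \<longlonglongrightarrow> indicator E x"
    and E [measurable]: "E \<in> sets lebesgue" and Ea: "E \<subseteq> {0..a}"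
  shows "(\<lambda>n. \<integral>\<^sup>+x. ennreal ((cmod (p n x))\<^sup>2) * w x * indicator {0..a} x \<partial>lebesgue)
      \<longlonglongrightarrow> (\<integral>\<^sup>+x. w x * indicator E x \<partial>lebesgue)"
proof (rule nn_integral_dominated_convergence[where w = "\<lambda>x. 4 * (w x * indicator {0..a} x)"])
  have [measurable]: "{0..a} \<in> sets lebesgue" by simp
  have [measurable]: "p n \<in> borel_measurable lebesgue" for n
    using p(1)[of n] by (auto simp: is_trig_poly_def intro: trig_poly_measurable)
  show "(\<lambda>x. ennreal ((cmod (p n x))\<^sup>2) * w x * indicator {0..a} x) \<in> borel_measurable lebesgue" for n
    by measurable
  show "(\<lambda>x. w x * indicator E x) \<in> borel_measurable lebesgue"
    "(\<lambda>x. 4 * (w x * indicator {0..a} x)) \<in> borel_measurable lebesgue"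
    by measurable
  show "AE x in lebesgue. ennreal ((cmod (p n x))\<^sup>2) * w x * indicator {0..a} x \<le> 4 * (w x * indicator {0..a} x)" for n
  proof (intro AE_I2)
    fix x
    have "ennreal ((cmod (p n x))\<^sup>2) \<le> 4" if "x \<in> {0..a}"
      using power_mono[OF p(2)[OF that, of n] norm_ge_zero, of 2] ennreal_leI[of _ 4] by simp
    then show "ennreal ((cmod (p n x))\<^sup>2) * w x * indicator {0..a} x \<le> 4 * (w x * indicator {0..a} x)"
      by (auto simp: indicator_def intro!: mult_right_mono)
  qed
  show "(\<integral>\<^sup>+x. 4 * (w x * indicator {0..a} x) \<partial>lebesgue) < \<infinity>"
    using fin by (subst nn_integral_cmult) (auto simp: ennreal_mult_less_top)
  \<comment> \<open>Finiteness matters because multiplication by infinity is not continuous in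
    \<open>ennreal\<close>: where w is infinite the products need not tend to 0 when p does.\<close>
  have "AE x in lebesgue. w x * indicator {0..a} x \<noteq> \<infinity>"
    using fin by (intro nn_integral_noteq_infinite) (auto simp: less_top)
  with lim show "AE x in lebesgue. (\<lambda>n. ennreal ((cmod (p n x))\<^sup>2) * w x * indicator {0..a} x) \<longlonglongrightarrow> w x * indicator E x"
  proof eventually_elim
    case (elim x)
    show ?case
    proof (cases "x \<in> {0..a}")
      case True
      with elim have "(\<lambda>n. ennreal ((cmod (p n x))\<^sup>2)) \<longlonglongrightarrow> ennreal ((cmod (indicator E x))\<^sup>2)"
        by (intro tendsto_ennrealI tendsto_intros) simp
      with True elim have "(\<lambda>n. w x * ennreal ((cmod (p n x))\<^sup>2)) \<longlonglongrightarrow> w x * ennreal ((cmod (indicator E x))\<^sup>2)"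
        by (intro ennreal_tendsto_cmult) (auto simp: less_top)
      with True show ?thesis by (cases "x \<in> E") (simp_all add: mult.commute)
    qed (use Ea in \<open>auto simp: indicator_def\<close>)
  qed
qed

lemma nn_integral_bracket_self:
  assumes "a > 0" "g \<in> L2"
  shows "(\<integral>\<^sup>+x. bracket_self a g x * indicator {0..a} x \<partial>lebesgue) = ennreal ((norm_L2 g)\<^sup>2)"
  using nn_integral_periodic_mult[OF assms(1) L2_measurable[OF assms(2)], of "\<lambda>_. 1"] norm_L2_sq_nn[OF assms(2)]
  by simp

text \<open>The Riesz inequalities are tested with polynomials tending to the indicator of E: the
  coefficient sums times a are integrals with weight 1 and tend to the measure of E, while the
  squared norms are integrals weighted by the bracket.\<close>

lemma riesz_bounds_imp_set_bounds:
  assumes a: "a > 0" and g: "g \<in> L2" and AB: "A \<ge> 0" "B \<ge> 0"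
    and rb: "riesz_bounds (\<lambda>m. modulation (of_int m / a) g) (a * A) (a * B)"
    and E: "E \<in> sets lebesgue" "E \<subseteq> {0..a}"
  shows "ennreal A * emeasure lebesgue E \<le> (\<integral>\<^sup>+x. bracket_self a g x * indicator E x \<partial>lebesgue)"
    and "(\<integral>\<^sup>+x. bracket_self a g x * indicator E x \<partial>lebesgue) \<le> ennreal B * emeasure lebesgue E"
proof -
  let ?f = "\<lambda>m. modulation (of_int m / a) g"
  obtain p where p: "\<And>n. is_trig_poly a (p n)" "\<And>n x. x \<in> {0..a} \<Longrightarrow> cmod (p n x) \<le> 2"
    "AE x in lebesgue. x \<in> {0..a} \<longrightarrow> (\<lambda>n. p n x) \<longlonglongrightarrow> indicator E x"
    using trig_poly_approx_indicator[OF a E] by blast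
  let ?I = "\<lambda>w n. \<integral>\<^sup>+x. ennreal ((cmod (p n x))\<^sup>2) * w x * indicator {0..a} x \<partial>lebesgue"
  have le: "ennreal A * ?I (\<lambda>_. 1) n \<le> ?I (bracket_self a g) n"
    "?I (bracket_self a g) n \<le> ennreal B * ?I (\<lambda>_. 1) n" for n
  proof -
    obtain F c where F: "finite F" "p n = trig_poly a c F"
      using p(1)[of n, unfolded is_trig_poly_def] by blast
    have I: "?I (\<lambda>_. 1) n = ennreal (a * (\<Sum>m\<in>F. (cmod (c m))\<^sup>2))"
      using nn_integral_trig_poly[OF a F(1), of c] by (simp add: F)
    have C: "ennreal C * ?I (\<lambda>_. 1) n = ennreal (a * C * (\<Sum>m\<in>F. (cmod (c m))\<^sup>2))" if "C \<ge> 0" for C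
      unfolding I ennreal_mult'[OF that, symmetric] by (simp add: mult_ac)
    have W: "?I (bracket_self a g) n = ennreal ((norm_L2 (lincomb ?f c F))\<^sup>2)"
      unfolding F by (rule norm_L2_lincomb_modulation[OF a g, symmetric])
    show "ennreal A * ?I (\<lambda>_. 1) n \<le> ?I (bracket_self a g) n"
      unfolding C[OF AB(1)] W by (rule ennreal_leI[OF riesz_boundsD(1)[OF rb F(1)]])
    show "?I (bracket_self a g) n \<le> ennreal B * ?I (\<lambda>_. 1) n"
      unfolding C[OF AB(2)] W by (rule ennreal_leI[OF riesz_boundsD(2)[OF rb F(1)]])
  qed
  have lim_w: "?I (bracket_self a g) \<longlonglongrightarrow> (\<integral>\<^sup>+x. bracket_self a g x * indicator E x \<partial>lebesgue)"
    by (rule nn_integral_trig_poly_weight_limit[OF bracket_self_measurable[OF L2_measurable[OF g]] _ p E])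
       (simp add: nn_integral_bracket_self[OF a g])
  have "?I (\<lambda>_. 1) \<longlonglongrightarrow> (\<integral>\<^sup>+x. 1 * indicator E x \<partial>lebesgue)"
    by (rule nn_integral_trig_poly_weight_limit[OF _ _ p E]) (auto simp: emeasure_lborel_Icc_eq)
  then have lim_1: "?I (\<lambda>_. 1) \<longlonglongrightarrow> emeasure lebesgue E"
    using E(1) by simp
  have lim_C: "(\<lambda>n. ennreal C * ?I (\<lambda>_. 1) n) \<longlonglongrightarrow> ennreal C * emeasure lebesgue E" for C
    by (rule ennreal_tendsto_cmult[OF _ lim_1]) simp
  show "ennreal A * emeasure lebesgue E \<le> (\<integral>\<^sup>+x. bracket_self a g x * indicator E x \<partial>lebesgue)"
    by (rule LIMSEQ_le[OF lim_C lim_w]) (use le in blast)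
  show "(\<integral>\<^sup>+x. bracket_self a g x * indicator E x \<partial>lebesgue) \<le> ennreal B * emeasure lebesgue E"
    by (rule LIMSEQ_le[OF lim_w lim_C]) (use le in blast)
qed

text \<open>A violation is considered with a margin e > 0 and inside one period; integrating over
  the set E where it occurs contradicts the set inequality unless E is null. Letting e tend to 0 and
  using periodicity removes both restrictions.\<close>

lemma riesz_bounds_imp_bracket_bounds:
  assumes a: "a > 0" and g: "g \<in> L2" and AB: "A \<ge> 0" "B \<ge> 0"
    and rb: "riesz_bounds (\<lambda>m. modulation (of_int m / a) g) (a * A) (a * B)"
  shows "bracket_bounds a g A B"
proof -
  let ?w = "bracket_self a g"
  note w [measurable] = bracket_self_measurable[OF L2_measurable[OF g], of a]
  have [measurable]: "{0..a} \<in> sets lebesgue" by simp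
  \<comment> \<open>Only a finite I can be cancelled in \<open>ennreal\<close>; in the two
    applications it is the integral of the bracket over E and a multiple of the measure of
    E.\<close>
  have null: "AE x in lebesgue. x \<notin> E" if "E \<in> sets lebesgue" "E \<subseteq> {0..a}"
    and le: "ennreal e * emeasure lebesgue E + I \<le> I" "I < \<infinity>" "e > 0" for E I e
  proof -
    have "ennreal e * emeasure lebesgue E = 0"
      using le(1,2) ennreal_add_left_cancel_le[of I "ennreal e * emeasure lebesgue E" 0]
      by (auto simp: add.commute)
    then have "emeasure lebesgue E = 0" using \<open>e > 0\<close> by simp
    then show ?thesis using that(1) by (intro AE_not_in) (auto simp: null_sets_def)
  qed
  have finE: "emeasure lebesgue E < \<infinity>" if "E \<in> sets lebesgue" "E \<subseteq> {0..a}" for E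
    by (rule le_less_trans[OF emeasure_mono[OF that(2)]]) (simp_all add: emeasure_lborel_Icc_eq)
  have "AE x in lebesgue. x \<in> {0..a} \<longrightarrow> ?w x \<in> {ennreal A..}"
  proof -
    have "AE x in lebesgue. ennreal A * indicator {0..a} x \<le> ?w x * indicator {0..a} x"
    proof (rule AE_upper_bound_inf_ennreal)
      fix e :: real assume e: "e > 0"
      define E where "E = {x \<in> {0..a}. ?w x + ennreal e < ennreal A}"
      have E: "E \<in> sets lebesgue" "E \<subseteq> {0..a}" unfolding E_def by (measurable, auto)
      let ?I = "\<integral>\<^sup>+x. ?w x * indicator E x \<partial>lebesgue"
      have "ennreal e * emeasure lebesgue E + ?I = (\<integral>\<^sup>+x. (ennreal e + ?w x) * indicator E x \<partial>lebesgue)"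
        using E(1) by (simp add: distrib_right nn_integral_add nn_integral_cmult_indicator)
      also have "\<dots> \<le> (\<integral>\<^sup>+x. ennreal A * indicator E x \<partial>lebesgue)"
        by (intro nn_integral_mono) (auto simp: E_def indicator_def add.commute)
      also have "\<dots> = ennreal A * emeasure lebesgue E"
        using E(1) by (rule nn_integral_cmult_indicator)
      also note riesz_bounds_imp_set_bounds(1)[OF a g AB rb E]
      finally have "ennreal e * emeasure lebesgue E + ?I \<le> ?I" .
      moreover have "?I < \<infinity>"
        using riesz_bounds_imp_set_bounds(2)[OF a g AB rb E] finE[OF E]
        by (auto simp: ennreal_mult_less_top intro: le_less_trans)
      ultimately have "AE x in lebesgue. x \<notin> E" using null[OF E] e by blast
      then show "AE x in lebesgue. ennreal A * indicator {0..a} x \<le> ?w x * indicator {0..a} x + ennreal e"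
        by eventually_elim (auto simp: E_def indicator_def)
    qed
    then show ?thesis by eventually_elim (auto simp: indicator_def split: if_splits)
  qed
  then have lower: "AE x in lebesgue. ?w x \<in> {ennreal A..}"
    by (rule AE_periodic[OF a w bracket_self_periodic, rotated]) simp
  have "AE x in lebesgue. x \<in> {0..a} \<longrightarrow> ?w x \<in> {..ennreal B}"
  proof -
    have "AE x in lebesgue. ?w x * indicator {0..a} x \<le> ennreal B * indicator {0..a} x"
    proof (rule AE_upper_bound_inf_ennreal)
      fix e :: real assume e: "e > 0"
      define E where "E = {x \<in> {0..a}. ennreal B + ennreal e < ?w x}"
      have E: "E \<in> sets lebesgue" "E \<subseteq> {0..a}" unfolding E_def by (measurable, auto)
      have "ennreal e * emeasure lebesgue E + ennreal B * emeasure lebesgue E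
          = (\<integral>\<^sup>+x. (ennreal e + ennreal B) * indicator E x \<partial>lebesgue)"
        unfolding nn_integral_cmult_indicator[OF E(1)] by (rule distrib_right[symmetric])
      also have "\<dots> \<le> (\<integral>\<^sup>+x. ?w x * indicator E x \<partial>lebesgue)"
        by (intro nn_integral_mono) (auto simp: E_def indicator_def add.commute)
      also note riesz_bounds_imp_set_bounds(2)[OF a g AB rb E]
      finally have "ennreal e * emeasure lebesgue E + ennreal B * emeasure lebesgue E
        \<le> ennreal B * emeasure lebesgue E" .
      moreover have "ennreal B * emeasure lebesgue E < \<infinity>"
        using finE[OF E] by (simp add: ennreal_mult_less_top)
      ultimately have "AE x in lebesgue. x \<notin> E" using null[OF E] e by blast
      then show "AE x in lebesgue. ?w x * indicator {0..a} x \<le> ennreal B * indicator {0..a} x + ennreal e"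
        by eventually_elim (auto simp: E_def indicator_def)
    qed
    then show ?thesis by eventually_elim (auto simp: indicator_def split: if_splits)
  qed
  then have upper: "AE x in lebesgue. ?w x \<in> {..ennreal B}"
    by (rule AE_periodic[OF a w bracket_self_periodic, rotated]) simp
  show ?thesis
    unfolding bracket_bounds_def using lower upper by eventually_elim simp
qed

section \<open>Changing the constants and assembling the equivalences\<close>

lemma has_riesz_constants_mono:
  assumes "has_riesz_constants f \<alpha> \<beta>" "0 \<le> \<alpha>'" "\<alpha>' \<le> \<alpha>" "0 \<le> \<beta>" "\<beta> \<le> \<beta>'"
  shows "has_riesz_constants f \<alpha>' \<beta>'"
  unfolding has_riesz_constants_def
proof (intro allI impI)
  fix c :: "int \<Rightarrow> complex"
  assume "(\<lambda>m. (cmod (c m))\<^sup>2) summable_on UNIV"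
  then obtain s where s: "has_sum_L2 (\<lambda>m x. c m * f m x) s"
    "\<alpha>\<^sup>2 * (\<Sum>\<^sub>\<infinity>m. (cmod (c m))\<^sup>2) \<le> (norm_L2 s)\<^sup>2" "(norm_L2 s)\<^sup>2 \<le> \<beta>\<^sup>2 * (\<Sum>\<^sub>\<infinity>m. (cmod (c m))\<^sup>2)"
    using assms(1) unfolding has_riesz_constants_def by auto
  have "0 \<le> (\<Sum>\<^sub>\<infinity>m. (cmod (c m))\<^sup>2)" by (rule infsum_nonneg) simp
  then have "\<alpha>'\<^sup>2 * (\<Sum>\<^sub>\<infinity>m. (cmod (c m))\<^sup>2) \<le> \<alpha>\<^sup>2 * (\<Sum>\<^sub>\<infinity>m. (cmod (c m))\<^sup>2)"
    "\<beta>\<^sup>2 * (\<Sum>\<^sub>\<infinity>m. (cmod (c m))\<^sup>2) \<le> \<beta>'\<^sup>2 * (\<Sum>\<^sub>\<infinity>m. (cmod (c m))\<^sup>2)"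
    using assms by (auto intro!: mult_right_mono power_mono)
  with s show "\<exists>s. has_sum_L2 (\<lambda>m x. c m * f m x) s \<and>
      \<alpha>'\<^sup>2 * (\<Sum>\<^sub>\<infinity>m. (cmod (c m))\<^sup>2) \<le> (norm_L2 s)\<^sup>2 \<and> (norm_L2 s)\<^sup>2 \<le> \<beta>'\<^sup>2 * (\<Sum>\<^sub>\<infinity>m. (cmod (c m))\<^sup>2)"
    by (intro exI[of _ s]) auto
qed

lemma bracket_bounds_mono:
  assumes "bracket_bounds a g A B" "A' \<le> A" "B \<le> B'"
  shows "bracket_bounds a g A' B'"
  using assms(1) unfolding bracket_bounds_def
proof eventually_elim
  case (elim t)
  then show ?case
    using ennreal_leI[OF assms(2)] ennreal_leI[OF assms(3)] by (meson order_trans)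
qed

theorem theorem7p3:
  fixes a b :: real and g :: "real \<Rightarrow> complex"
  assumes "a > 0" and "g \<in> L2"
  shows
    "((\<exists>A>0. \<exists>B>0. bracket_bounds a g A B) \<longleftrightarrow>
        riesz_basic_sequence (\<lambda>m. modulation (of_int m / a) g)) \<and>
     (a * b = 1 \<longrightarrow>
        ((\<exists>A>0. \<exists>B>0. bracket_bounds a g A B) \<longleftrightarrow>
          (\<exists>A>0. \<exists>B>0. bracket_bounds a g A B \<and>
             riesz_basic_sequence (\<lambda>m. modulation (of_int m * b) g) \<and>
             has_riesz_constants (\<lambda>m. modulation (of_int m * b) g) (sqrt A) (sqrt B))) \<and>
        (riesz_basic_sequence (\<lambda>m. modulation (of_int m / a) g) \<longleftrightarrow>
          (\<exists>A>0. \<exists>B>0. bracket_bounds a g A B \<and>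
             riesz_basic_sequence (\<lambda>m. modulation (of_int m * b) g) \<and>
             has_riesz_constants (\<lambda>m. modulation (of_int m * b) g) (sqrt A) (sqrt B))) \<and>
        (\<forall>A>0. \<forall>B>0. bracket_bounds a g A B \<longleftrightarrow>
             riesz_basic_sequence (\<lambda>m. modulation (of_int m * b) g) \<and>
             has_riesz_constants (\<lambda>m. modulation (of_int m * b) g) (sqrt (a * A)) (sqrt (a * B))))"
proof -
  let ?f = "\<lambda>m. modulation (of_int m / a) g"
  have f: "?f m \<in> L2" for m by (rule L2_modulation[OF assms(2)])
  have bounds: "riesz_bounds ?f (a * A) (a * B)" if "A > 0" "B > 0" "bracket_bounds a g A B" for A B
    using that assms by (intro bracket_bounds_imp_riesz_bounds) auto
  have basic: "riesz_basic_sequence ?f" if "A > 0" "B > 0" "bracket_bounds a g A B" for A B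
    using bounds[OF that] assms(1) that by (intro riesz_bounds_imp_riesz_basic_sequence[where A = "a * A" and B = "a * B"] f) auto
  have constants: "has_riesz_constants ?f (sqrt (a * A)) (sqrt (a * B))"
    if "A > 0" "B > 0" "bracket_bounds a g A B" for A B
    using bounds[OF that] assms(1) that by (intro riesz_bounds_imp_has_riesz_constants f) auto
  \<comment> \<open>Dividing by a undoes the factor that integration of |p|^2 over a period
    produces.\<close>
  have converse: "\<exists>A>0. \<exists>B>0. bracket_bounds a g A B" if rbs: "riesz_basic_sequence ?f"
  proof -
    obtain A B where AB: "A > 0" "B > 0" "riesz_bounds ?f A B"
      using riesz_basic_sequence_imp_riesz_bounds[OF rbs] by blast
    then have "bracket_bounds a g (A / a) (B / a)"
      using assms by (intro riesz_bounds_imp_bracket_bounds) auto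
    moreover have "A / a > 0" "B / a > 0" using AB assms(1) by auto
    ultimately show ?thesis by blast
  qed
  have conj1: "(\<exists>A>0. \<exists>B>0. bracket_bounds a g A B) \<longleftrightarrow> riesz_basic_sequence ?f"
    using basic converse by blast
  \<comment> \<open>The pair from (1) gives squared constants a A and a B; passing to min A (a A)
    and max B (a B) weakens both statements to one common pair.\<close>
  have same: "\<exists>A>0. \<exists>B>0. bracket_bounds a g A B \<and> riesz_basic_sequence ?f \<and>
      has_riesz_constants ?f (sqrt A) (sqrt B)"
    if AB: "A > 0" "B > 0" "bracket_bounds a g A B" for A B
  proof -
    have "bracket_bounds a g (min A (a * A)) (max B (a * B))"
      by (rule bracket_bounds_mono[OF AB(3)]) auto
    moreover have "has_riesz_constants ?f (sqrt (min A (a * A))) (sqrt (max B (a * B)))"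
      by (rule has_riesz_constants_mono[OF constants[OF AB]]) (use AB assms(1) in auto)
    moreover have "min A (a * A) > 0" "max B (a * B) > 0" using AB assms(1) by auto
    ultimately show ?thesis using basic[OF AB] by blast
  qed
  \<comment> \<open>Finite sums recover the bracket bounds without loss of constants, which gives
    the converse for each fixed pair and not only for some pair.\<close>
  have sharp: "bracket_bounds a g A B"
    if "A > 0" "B > 0" "has_riesz_constants ?f (sqrt (a * A)) (sqrt (a * B))" for A B
    using that assms
    by (intro riesz_bounds_imp_bracket_bounds has_riesz_constants_imp_riesz_bounds f) auto
  show ?thesis
  proof (intro conjI impI conj1)
    assume "a * b = 1"
    then have "b = 1 / a" using assms(1) by (simp add: field_simps)
    then have fb: "(\<lambda>m. modulation (of_int m * b) g) = ?f" by simp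
    show "(\<exists>A>0. \<exists>B>0. bracket_bounds a g A B) \<longleftrightarrow>
          (\<exists>A>0. \<exists>B>0. bracket_bounds a g A B \<and>
             riesz_basic_sequence (\<lambda>m. modulation (of_int m * b) g) \<and>
             has_riesz_constants (\<lambda>m. modulation (of_int m * b) g) (sqrt A) (sqrt B))"
      unfolding fb using same by blast
    then show "riesz_basic_sequence ?f \<longleftrightarrow>
          (\<exists>A>0. \<exists>B>0. bracket_bounds a g A B \<and>
             riesz_basic_sequence (\<lambda>m. modulation (of_int m * b) g) \<and>
             has_riesz_constants (\<lambda>m. modulation (of_int m * b) g) (sqrt A) (sqrt B))"
      unfolding conj1 .
    show "\<forall>A>0. \<forall>B>0. bracket_bounds a g A B \<longleftrightarrow>
             riesz_basic_sequence (\<lambda>m. modulation (of_int m * b) g) \<and>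
             has_riesz_constants (\<lambda>m. modulation (of_int m * b) g) (sqrt (a * A)) (sqrt (a * B))"
      unfolding fb using basic constants sharp by blast
  qed
qed

end
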